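(* Let $p$ be a probability density on $\mathbb{R}^d$, let $f:\mathbb{R}_+\to\mathbb{R}$, and let $(a,b)\in\mathbb{R}^2$. Let $k\in\mathbb{N}$ be fixed with $k>-2a$, and suppose that the estimator function $\phi_k$ of $f$ with parameter $k$ exists and satisfies $|\phi_k(u)|\le C\psi_{a,b}(u)$ for all $u>0$ and some constant $C$. Suppose that: (i) there exists $0<C_p<\infty$ with $p(x)\le C_p$ for almost every $x$; (ii) there exists $c_p>0$ with $p(x)\ge c_p$ for $x\in\operatorname{supp}(p)$; (iii) $\operatorname{supp}(p)$ is bounded; (iv) there exists $r>0$ such that $\displaystyle\inf_{x\in\operatorname{supp}(p)}\inf_{r'\in(0,r]}\frac{\mathrm{Leb}(B(x,r')\cap\operatorname{supp}(p))}{\mathrm{Leb}(B(x,r'))}>0$. Then, as $m\to\infty$, $$\operatorname{Var}\bigl(\hat T_f^{(k)}(X_1,\ldots,X_m)\bigr)=O(m^{-1}).$$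
   Context: $\mathrm{Leb}$ is Lebesgue measure on $\mathbb{R}^d$ with Euclidean norm $\|\cdot\|$; $B(x,r)=\{y:\|x-y\|<r\}$. $P$ is the probability measure with density $p$, $\operatorname{supp}(p)=\{x:P(B(x,r))>0\ \forall r>0\}$, and $X_1,X_2,\ldots$ are i.i.d. with density $p$. For a finite set $A$, $r_k(x|A)$ is the distance from $x$ to its $k$-th nearest neighbor in $A$ (ties broken arbitrarily). Estimator function: $\phi_k(u)=\frac{\Gamma(k)}{u^{k-1}}\mathcal{L}^{-1}\{f(p)/p^k\}(u)$, where $\mathcal{L}^{-1}$ is the inverse of the one-sided Laplace transform; that is, $\phi_k:(0,\infty)\to\mathbb{R}$ is a function with $\int_0^\infty u^{k-1}\phi_k(u)e^{-su}\,du=\Gamma(k)f(s)/s^k$ for all $s>0$. Estimator: for $m\ge k+1$, $U_{km}(X_i)=(m-1)\,\mathrm{Leb}\bigl(B(X_i,r_k(X_i|\{X_j:j\ne i\}))\bigr)$ and $\hat T_f^{(k)}(X_1,\ldots,X_m)=\frac1m\sum_{i=1}^m\phi_k(U_{km}(X_i))$. Polynomial envelope: $\psi_{a,b}(u)=u^a$ for $0<u\le1$ and $\psi_{a,b}(u)=u^b$ for $u>1$. *)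

theory Defs
  imports "HOL-Probability.Probability" "HOL-Library.Landau_Symbols"
begin

definition density_supp :: "('a::euclidean_space \<Rightarrow> real) \<Rightarrow> 'a set" where
  "density_supp p =
     {x. \<forall>r>0. 0 < measure (density lborel (\<lambda>y. ennreal (p y))) (ball x r)}"

text \<open>Distances are counted with multiplicity, so equidistant points of \<open>A\<close> occupy
  several positions. The value is meaningful for finite \<open>A\<close> and \<open>1 \<le> k \<le> card A\<close>.\<close>

definition knn_dist :: "nat \<Rightarrow> 'a::metric_space \<Rightarrow> 'a set \<Rightarrow> real" where
  "knn_dist k x A = sorted_list_of_multiset (image_mset (dist x) (mset_set A)) ! (k - 1)"

lemma knn_dist_enum:
  assumes "set ys = A" "distinct ys" "sorted (map (dist x) ys)"
    and "1 \<le> k" "k \<le> card A"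
  shows "knn_dist k x A = dist x (ys ! (k - 1))"
proof -
  have "mset_set A = mset ys"
    using assms(1,2) by (metis mset_set_set)
  then have "sorted_list_of_multiset (image_mset (dist x) (mset_set A)) = map (dist x) ys"
    using assms(3) by (metis mset_map sort_key_id_if_sorted sorted_sort_id sorted_list_of_multiset_mset)
  moreover have "k - 1 < length ys"
    using assms by (metis One_nat_def Suc_le_lessD Suc_pred distinct_card less_eq_Suc_le)
  ultimately show ?thesis
    unfolding knn_dist_def by simp
qed

text \<open>Integrability over \<open>lborel\<close> also makes \<open>\<phi>\<close> Borel measurable on \<open>{0<..}\<close>.
  Values of \<open>\<phi>\<close> outside \<open>{0<..}\<close> and of \<open>f\<close> outside \<open>{0<..}\<close> are irrelevant.\<close>

definition estimator_function :: "nat \<Rightarrow> (real \<Rightarrow> real) \<Rightarrow> (real \<Rightarrow> real) \<Rightarrow> bool" where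
  "estimator_function k f \<phi> \<longleftrightarrow>
     (\<forall>s>0. set_integrable lborel {0<..} (\<lambda>u. u ^ (k - 1) * \<phi> u * exp (- s * u)) \<and>
            (LBINT u:{0<..}. u ^ (k - 1) * \<phi> u * exp (- s * u)) = Gamma (real k) * f s / s ^ k)"

definition poly_envelope :: "real \<Rightarrow> real \<Rightarrow> real \<Rightarrow> real" where
  "poly_envelope a b u = (if u \<le> 1 then u powr a else u powr b)"

text \<open>The sample is \<open>xs 1, \<dots>, xs m\<close>.\<close>

definition knn_volume :: "nat \<Rightarrow> nat \<Rightarrow> (nat \<Rightarrow> 'a::euclidean_space) \<Rightarrow> nat \<Rightarrow> real" where
  "knn_volume k m xs i =
     (real m - 1) * measure lborel (ball (xs i) (knn_dist k (xs i) (xs ` ({1..m} - {i}))))"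

definition knn_estimator ::
    "nat \<Rightarrow> (real \<Rightarrow> real) \<Rightarrow> nat \<Rightarrow> (nat \<Rightarrow> 'a::euclidean_space) \<Rightarrow> real" where
  "knn_estimator k \<phi> m xs = (\<Sum>i=1..m. \<phi> (knn_volume k m xs i)) / real m"

end

theory Submission
  imports Defs "HOL-Real_Asymp.Real_Asymp"
begin

text \<open>
  The variance is controlled by the Efron-Stein inequality: if \<open>T\<close> is a function of independent
  variables indexed by \<open>I\<close> and \<open>T\<^sub>i\<close> is a function of all of them except the \<open>i\<close>-th, then
  \<open>Var T \<le> (\<Sum>i\<in>I. E (T - T\<^sub>i)\<^sup>2)\<close> (\<open>Efron_Stein\<close>). It is applied to the estimator \<open>T\<close> on \<open>m\<close> points
  and to \<open>T\<^sub>i\<close>, the same sum with the point \<open>i\<close> deleted but with the normalisations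
  \<open>1 / m\<close> and \<open>m - 1\<close> kept.

  Deleting the point \<open>i\<close> removes its own term and changes the term of \<open>j\<close> only when \<open>X\<^sub>i\<close> is one of
  the \<open>k\<close> nearest neighbours of \<open>X\<^sub>j\<close>; in that case the \<open>k\<close>-th neighbour distance of \<open>X\<^sub>j\<close> becomes its
  \<open>(k+1)\<close>-st one (\<open>knn_dist_remove\<close>). Each \<open>j\<close> is affected
  by at most \<open>k\<close> points \<open>i\<close>, and each \<open>i\<close> affects at most \<open>K k\<close> points \<open>j\<close>, where \<open>K\<close> depends only on the dimension: cover the unit sphere by \<open>K\<close> sets of diameter less than \<open>1\<close>;
  among the points seen from \<open>X\<^sub>i\<close> in directions of one of these sets, the farthest is closer to all
  the others than to \<open>X\<^sub>i\<close> (\<open>cone_cover\<close>). With Cauchy-Schwarz,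
  \<open>(\<Sum>i\<in>I. (T - T\<^sub>i)\<^sup>2)\<close> is almost surely at most a constant times
  \<open>m\<^sup>-\<^sup>2 (\<Sum>j\<in>I. Y\<^sub>j\<^sup>2 + Z\<^sub>j\<^sup>2)\<close>, where \<open>Y\<^sub>j\<close> and \<open>Z\<^sub>j\<close> are \<open>\<phi>\<close> evaluated at
  the neighbour volumes of rank \<open>k\<close> and \<open>k+1\<close> (\<open>knn_sum_leave_one_out_le\<close>).

  It remains to bound \<open>E Y\<^sub>j\<^sup>2\<close> and \<open>E Z\<^sub>j\<^sup>2\<close> uniformly in \<open>m\<close>. The envelope reduces this to the tails
  of the neighbour volume \<open>U\<close> (\<open>knn_volume_tails\<close>). If \<open>U \<le> t\<close>, then \<open>k\<close> sample points lie in a ball of mass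
  \<open>O(t / m)\<close>, so a union bound over the choice of these points gives \<open>P(U \<le> t) = O(t\<^sup>k)\<close>,
  which makes \<open>E U\<^sup>2\<^sup>a\<close> finite near \<open>0\<close> because \<open>k > - 2 a\<close>. If \<open>U > t\<close>, then a ball of mass at least
  \<open>c t / m\<close> contains fewer than \<open>k\<close> points, and a Chernoff bound gives an exponential tail, which
  controls every power at infinity. The lower bound on the mass of balls is where
  the lower bound on the density, the regularity of the support and its boundedness enter.
\<close>

section \<open>Order statistics of distances and deletion of a point\<close>

lemma sorted_nth_le_iff:
  fixes xs :: "'b::linorder list"
  assumes "sorted xs" "i < length xs"
  shows "xs ! i \<le> r \<longleftrightarrow> i < length (filter (\<lambda>y. y \<le> r) xs)"
proof -
  have tw: "filter (\<lambda>y. y \<le> r) xs = takeWhile (\<lambda>y. y \<le> r) xs"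
    using assms(1)
  proof (induction xs)
    case (Cons a xs)
    have "filter (\<lambda>y. y \<le> r) xs = []" if "\<not> a \<le> r"
      using that Cons.prems by (force intro: filter_False)
    with Cons show ?case by (cases "a \<le> r") auto
  qed simp
  show ?thesis
  proof
    assume le: "xs ! i \<le> r"
    have "\<forall>j<Suc i. xs ! j \<le> r"
      using assms le by (meson less_Suc_eq_le order_trans sorted_nth_mono)
    then have "Suc i \<le> length (takeWhile (\<lambda>y. y \<le> r) xs)"
      using assms(2) by (intro length_takeWhile_less_P_nth) auto
    then show "i < length (filter (\<lambda>y. y \<le> r) xs)" by (simp add: tw)
  next
    assume "i < length (filter (\<lambda>y. y \<le> r) xs)"
    then show "xs ! i \<le> r"
      unfolding tw by (metis nth_mem set_takeWhileD takeWhile_nth)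
  qed
qed

lemma length_sorted_list_of_multiset: "length (sorted_list_of_multiset M) = size M"
  by (metis mset_sorted_list_of_multiset size_mset)

text \<open>The distance enters all later arguments through this counting criterion, which is
  insensitive to ties.\<close>

lemma knn_dist_le_iff:
  assumes "finite A" "1 \<le> k" "k \<le> card A"
  shows "knn_dist k x A \<le> r \<longleftrightarrow> k \<le> card {y\<in>A. dist x y \<le> r}"
proof -
  define L where "L = sorted_list_of_multiset (image_mset (dist x) (mset_set A))"
  have len: "length L = card A"
    by (simp add: L_def length_sorted_list_of_multiset)
  have mL: "mset L = image_mset (dist x) (mset_set A)"
    by (simp add: L_def)
  have "length (filter (\<lambda>y. y \<le> r) L) = size (filter_mset (\<lambda>y. y \<le> r) (mset L))"
    by (metis mset_filter size_mset)
  also have "\<dots> = card {y\<in>A. dist x y \<le> r}"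
    using assms(1) unfolding mL by (simp add: filter_mset_image_mset)
  finally have flt: "length (filter (\<lambda>y. y \<le> r) L) = card {y\<in>A. dist x y \<le> r}" .
  have "L ! (k - 1) \<le> r \<longleftrightarrow> k - 1 < length (filter (\<lambda>y. y \<le> r) L)"
    by (rule sorted_nth_le_iff) (use assms len in \<open>auto simp: L_def\<close>)
  then show ?thesis
    unfolding knn_dist_def L_def[symmetric] flt using assms(2) by auto
qed

lemma knn_dist_nonneg:
  assumes "finite A" "1 \<le> k" "k \<le> card A"
  shows "0 \<le> knn_dist k x A"
proof (rule ccontr)
  assume "\<not> 0 \<le> knn_dist k x A"
  then have neg: "knn_dist k x A < 0" by simp
  have "k \<le> card {y\<in>A. dist x y \<le> knn_dist k x A}"
    using knn_dist_le_iff[OF assms, of x "knn_dist k x A"] by simp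
  moreover have "{y\<in>A. dist x y \<le> knn_dist k x A} = {}"
    using neg by (auto simp: not_le intro: less_le_trans)
  ultimately show False using assms(2) by simp
qed

lemma knn_dist_pos:
  assumes "finite A" "1 \<le> k" "k \<le> card A" "x \<notin> A"
  shows "0 < knn_dist k x A"
proof (rule ccontr)
  assume "\<not> 0 < knn_dist k x A"
  then have "k \<le> card {y\<in>A. dist x y \<le> 0}"
    using knn_dist_le_iff[OF assms(1-3), of x 0] by simp
  moreover have empty: "{y\<in>A. dist x y \<le> 0} = {}"
    using assms(4) by auto
  ultimately show False using assms(2) by (simp only: empty card.empty)
qed

text \<open>A change means that the closed ball of the old radius has lost its \<open>k\<close>-th point, hence held
  exactly \<open>k\<close> points including the deleted one. Ties are harmless: if deleting one of several points
  tied at the \<open>k\<close>-th distance leaves that distance unchanged, the deletion is not a change.\<close>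

lemma knn_dist_remove:
  assumes "finite A" "1 \<le> k" "k + 1 \<le> card A" "z \<in> A"
    and ne: "knn_dist k x (A - {z}) \<noteq> knn_dist k x A"
  shows "dist x z \<le> knn_dist k x A"
    and "card {y\<in>A. dist x y \<le> knn_dist k x A} = k"
    and "knn_dist k x (A - {z}) = knn_dist (k + 1) x A"
    and "card {y\<in>A - {z}. dist x y < dist x z} < k"
proof -
  define N where "N r = card {y\<in>A. dist x y \<le> r}" for r
  define N' where "N' r = card {y\<in>A - {z}. dist x y \<le> r}" for r
  define R where "R = knn_dist k x A"
  define R' where "R' = knn_dist k x (A - {z})"
  have card': "card (A - {z}) = card A - 1"
    using assms by simp
  have R: "R \<le> r \<longleftrightarrow> k \<le> N r" for r
    unfolding R_def N_def by (rule knn_dist_le_iff) (use assms in auto)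
  have R': "R' \<le> r \<longleftrightarrow> k \<le> N' r" for r
    unfolding R'_def N'_def by (rule knn_dist_le_iff) (use assms card' in auto)
  have R1: "knn_dist (k + 1) x A \<le> r \<longleftrightarrow> k + 1 \<le> N r" for r
    unfolding N_def by (rule knn_dist_le_iff) (use assms in auto)
  have N_in: "N r = N' r + 1" if "dist x z \<le> r" for r
  proof -
    have "{y\<in>A. dist x y \<le> r} = insert z {y\<in>A - {z}. dist x y \<le> r}"
      using that assms(4) by auto
    then show ?thesis using assms(1) by (simp add: N_def N'_def)
  qed
  have N_out: "N r = N' r" if "\<not> dist x z \<le> r" for r
    unfolding N_def N'_def using that by (intro arg_cong[where f = card]) auto
  have "R \<le> R'"
    using R[of R'] R'[of R'] N_in[of R'] N_out[of R'] by (cases "dist x z \<le> R'") auto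
  with ne have less: "R < R'" by (simp add: R_def R'_def)
  then have lt: "N' R < k" using R'[of R] by simp
  have ge: "k \<le> N R" using R[of R] by simp
  show 1: "dist x z \<le> knn_dist k x A"
    using lt ge N_out[of R] by (fold R_def) fastforce
  show 2: "card {y\<in>A. dist x y \<le> knn_dist k x A} = k"
    using lt ge N_in[of R] 1 by (fold R_def, fold N_def) simp
  have "R' \<le> r \<longleftrightarrow> knn_dist (k + 1) x A \<le> r" for r
  proof
    assume le: "R' \<le> r"
    then have "dist x z \<le> r" using 1 less by (simp add: R_def)
    then show "knn_dist (k + 1) x A \<le> r"
      using le R'[of r] R1[of r] N_in[of r] by simp
  next
    assume "knn_dist (k + 1) x A \<le> r"
    then show "R' \<le> r"
      using R'[of r] R1[of r] N_in[of r] N_out[of r] by (cases "dist x z \<le> r") auto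
  qed
  then show "knn_dist k x (A - {z}) = knn_dist (k + 1) x A"
    unfolding R'_def[symmetric] by (meson order_antisym order_refl)
  show "card {y\<in>A - {z}. dist x y < dist x z} < k"
  proof (rule ccontr)
    define Q where "Q = {y\<in>A - {z}. dist x y < dist x z}"
    assume "\<not> card {y\<in>A - {z}. dist x y < dist x z} < k"
    then have Q: "k \<le> card Q" by (simp add: Q_def)
    have fQ: "finite Q" using assms(1) by (simp add: Q_def)
    have neQ: "Q \<noteq> {}" using Q assms(2) by auto
    define s where "s = Max (dist x ` Q)"
    have "s \<in> dist x ` Q" unfolding s_def using fQ neQ by (intro Max_in) auto
    then have "s < dist x z" by (auto simp: Q_def)
    have "card Q \<le> N' s"
      unfolding N'_def s_def using assms(1) fQ by (intro card_mono) (auto simp: Q_def)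
    then have "R' \<le> s" using R' Q by simp
    then show False using \<open>s < dist x z\<close> 1 less by (simp add: R_def)
  qed
qed

lemma card_knn_dist_change_le:
  assumes "finite A" "1 \<le> k" "k + 1 \<le> card A"
  shows "card {z\<in>A. knn_dist k x (A - {z}) \<noteq> knn_dist k x A} \<le> k"
proof (cases "{z\<in>A. knn_dist k x (A - {z}) \<noteq> knn_dist k x A} = {}")
  case False
  then have "card {y\<in>A. dist x y \<le> knn_dist k x A} = k"
    using knn_dist_remove(2)[OF assms] by blast
  moreover have "card {z\<in>A. knn_dist k x (A - {z}) \<noteq> knn_dist k x A}
      \<le> card {y\<in>A. dist x y \<le> knn_dist k x A}"
    using assms(1) knn_dist_remove(1)[OF assms] by (intro card_mono) auto
  ultimately show ?thesis by simp
next
  case True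
  then show ?thesis by (simp only: card.empty)
qed

text \<open>Move from \<open>x\<close> radially towards \<open>z\<close> down to the distance of \<open>y\<close>, which costs the difference of the two
  distances, then across to \<open>y\<close>, which costs less than the distance of \<open>y\<close> from \<open>z\<close>.\<close>

lemma dist_lt_of_close_directions:
  fixes x y z :: "'a::real_normed_vector"
  assumes "y \<noteq> z" "dist y z \<le> dist x z" "dist (sgn (x - z)) (sgn (y - z)) < 1"
  shows "dist x y < dist x z"
proof -
  define p where "p = x - z"
  define q where "q = y - z"
  have q: "0 < norm q" using assms(1) by (simp add: q_def)
  have qp: "norm q \<le> norm p" using assms(2) by (simp add: p_def q_def dist_norm)
  have px: "norm p *\<^sub>R sgn p = p" and qx: "norm q *\<^sub>R sgn q = q"
    by (cases "p = 0"; simp add: sgn_div_norm) (cases "q = 0"; simp add: sgn_div_norm)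
  have sp: "norm (sgn p) = 1" using q qp by (auto simp: norm_sgn)
  have "p - q = (norm p - norm q) *\<^sub>R sgn p + norm q *\<^sub>R (sgn p - sgn q)"
    by (simp add: scaleR_diff_left scaleR_diff_right px qx)
  then have "norm (p - q) \<le> norm ((norm p - norm q) *\<^sub>R sgn p) + norm (norm q *\<^sub>R (sgn p - sgn q))"
    by (metis norm_triangle_ineq)
  also have "\<dots> = (norm p - norm q) + norm q * norm (sgn p - sgn q)"
    using qp sp by simp
  also have "\<dots> < (norm p - norm q) + norm q * 1"
    using q assms(3) by (simp add: p_def q_def dist_norm)
  finally show ?thesis by (simp add: p_def q_def dist_norm)
qed

text \<open>The constant is the number of balls of radius \<open>1/2\<close> that cover the unit sphere of directions.
  Among the points counted here whose direction from \<open>z\<close> lies in one such ball, the farthest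
  from \<open>z\<close> is closer to all the others than to \<open>z\<close>, so there are at most \<open>k\<close> of them.\<close>

lemma cone_cover:
  obtains K :: nat where "\<And>(P :: 'a::euclidean_space set) z k.
    finite P \<Longrightarrow> z \<notin> P \<Longrightarrow> card {x\<in>P. card {y\<in>P - {x}. dist x y < dist x z} < k} \<le> K * k"
proof -
  have "compact (sphere (0::'a) 1)" by simp
  then obtain C where C: "finite C" "sphere (0::'a) 1 \<subseteq> (\<Union>c\<in>C. ball c (1/2))"
    unfolding compact_eq_totally_bounded by (meson half_gt_zero zero_less_one)
  have "card {x\<in>P. card {y\<in>P - {x}. dist x y < dist x z} < k} \<le> card C * k"
    if P: "finite P" "z \<notin> P" for P :: "'a set" and z k
  proof -
    define S where "S = {x\<in>P. card {y\<in>P - {x}. dist x y < dist x z} < k}"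
    define Sc where "Sc c = {x\<in>S. sgn (x - z) \<in> ball c (1/2)}" for c
    have fS: "finite S" using P by (simp add: S_def)
    have "card (Sc c) \<le> k" for c
    proof (rule ccontr)
      assume "\<not> card (Sc c) \<le> k"
      then have big: "k < card (Sc c)" by simp
      have fin: "finite (Sc c)" using fS by (simp add: Sc_def)
      have ne: "Sc c \<noteq> {}" using big by auto
      obtain x where x: "x \<in> Sc c" "\<And>y. y \<in> Sc c \<Longrightarrow> dist y z \<le> dist x z"
      proof -
        have "Max ((\<lambda>y. dist y z) ` Sc c) \<in> (\<lambda>y. dist y z) ` Sc c"
          using fin ne by (intro Max_in) auto
        then obtain x where "x \<in> Sc c" "dist x z = Max ((\<lambda>y. dist y z) ` Sc c)"
          by auto
        then show ?thesis using fin by (intro that[of x]) (auto intro!: Max_ge)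
      qed
      have "Sc c - {x} \<subseteq> {y\<in>P - {x}. dist x y < dist x z}"
      proof
        fix y assume y: "y \<in> Sc c - {x}"
        have "dist (sgn (x - z)) (sgn (y - z)) < 1"
          using x(1) y by (auto simp: Sc_def intro: dist_triangle_half_r)
        moreover have "y \<noteq> z" using y P by (auto simp: Sc_def S_def)
        ultimately have "dist x y < dist x z"
          using dist_lt_of_close_directions x(2) y by blast
        then show "y \<in> {y\<in>P - {x}. dist x y < dist x z}"
          using y by (auto simp: Sc_def S_def)
      qed
      then have "card (Sc c - {x}) \<le> card {y\<in>P - {x}. dist x y < dist x z}"
        using P by (intro card_mono) auto
      moreover have "card {y\<in>P - {x}. dist x y < dist x z} < k"
        using x(1) by (auto simp: Sc_def S_def)
      ultimately show False using big x(1) fin by simp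
    qed
    moreover have "S \<subseteq> (\<Union>c\<in>C. Sc c)"
    proof
      fix x assume x: "x \<in> S"
      then have "sgn (x - z) \<in> sphere 0 1"
        using P by (auto simp: S_def norm_sgn)
      then have "sgn (x - z) \<in> (\<Union>c\<in>C. ball c (1/2))" using C(2) by blast
      then show "x \<in> (\<Union>c\<in>C. Sc c)" using x by (auto simp: Sc_def)
    qed
    ultimately have S: "S \<subseteq> (\<Union>c\<in>C. Sc c)" and Sc: "\<And>c. card (Sc c) \<le> k" by auto
    have "card S \<le> card (\<Union>c\<in>C. Sc c)"
      using C(1) fS by (intro card_mono S) (simp add: Sc_def)
    also have "\<dots> \<le> (\<Sum>c\<in>C. card (Sc c))" by (rule card_UN_le[OF C(1)])
    also have "\<dots> \<le> card C * k" using sum_bounded_above[of C "\<lambda>c. card (Sc c)" k] Sc by simp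
    finally have "card S \<le> card C * k" .
    then show ?thesis by (simp add: S_def)
  qed
  then show ?thesis using that by blast
qed

section \<open>Stability of nearest neighbour sums\<close>

text \<open>The weight \<open>h\<close> is a parameter, so that restricting the index set to \<open>I - {i}\<close> deletes one
  sample point while the volume normalisation hidden in \<open>h\<close> stays that of the full sample.\<close>

definition knn_sum :: "nat \<Rightarrow> (real \<Rightarrow> real) \<Rightarrow> 'i set \<Rightarrow> ('i \<Rightarrow> 'a::metric_space) \<Rightarrow> real" where
  "knn_sum k h I x = (\<Sum>j\<in>I. h (knn_dist k (x j) (x ` (I - {j}))))"

text \<open>Two counts are used: \<open>K\<close> bounds the number of terms affected by the deletion of one point,
  which pays for Cauchy-Schwarz, and \<open>k\<close> bounds the number of deletions that affect one term, which
  controls the double sum after exchanging the order of summation. An affected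
  term takes the value of rank \<open>k + 1\<close> in the full sample, so the right-hand side refers to the
  full sample only.\<close>

lemma knn_sum_leave_one_out_le:
  fixes x :: "'i \<Rightarrow> 'a::euclidean_space" and h :: "real \<Rightarrow> real"
  assumes I: "finite I" and inj: "inj_on x I" and k: "1 \<le> k" "k + 2 \<le> card I"
    and K: "\<And>(P :: 'a set) z. finite P \<Longrightarrow> z \<notin> P \<Longrightarrow>
      card {y\<in>P. card {w\<in>P - {y}. dist y w < dist y z} < k} \<le> K"
  shows "(\<Sum>i\<in>I. (knn_sum k h I x - knn_sum k h (I - {i}) x)\<^sup>2)
    \<le> (2 + 4 * real K * real k) * (\<Sum>j\<in>I. (h (knn_dist k (x j) (x ` (I - {j}))))\<^sup>2
        + (h (knn_dist (k + 1) (x j) (x ` (I - {j}))))\<^sup>2)"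
proof -
  define Y where "Y j = h (knn_dist k (x j) (x ` (I - {j})))" for j
  define Yt where "Yt j = h (knn_dist (k + 1) (x j) (x ` (I - {j})))" for j
  define Z where "Z i j = h (knn_dist k (x j) (x ` (I - {i} - {j})))" for i j
  define S where "S i = {j\<in>I - {i}. knn_dist k (x j) (x ` (I - {j}) - {x i})
      \<noteq> knn_dist k (x j) (x ` (I - {j}))}" for i
  define G where "G j = (Y j)\<^sup>2 + (Yt j)\<^sup>2" for j
  have img: "x ` (I - {i} - {j}) = x ` (I - {j}) - {x i}" if "i \<in> I" for i j
    using inj that by (auto simp: inj_on_def)
  have inj': "inj_on x (I - {j})" for j
    using inj by (rule inj_on_subset) auto
  have cardA: "card (x ` (I - {j})) = card I - 1" if "j \<in> I" for j
    using inj' that I by (simp add: card_image)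
  have A: "finite (x ` (I - {j}))" "k + 1 \<le> card (x ` (I - {j}))" if "j \<in> I" for j
    using I k cardA[OF that] by auto
  have ZS: "Z i j = Yt j" if "i \<in> I" "j \<in> S i" for i j
  proof -
    have "j \<in> I" "i \<noteq> j" using that by (auto simp: S_def)
    then have "knn_dist k (x j) (x ` (I - {j}) - {x i}) = knn_dist (k + 1) (x j) (x ` (I - {j}))"
      using that k(1) A by (intro knn_dist_remove(3)) (auto simp: S_def)
    then show ?thesis using img that by (simp add: Z_def Yt_def)
  qed
  have cardS: "card (S i) \<le> K" if i: "i \<in> I" for i
  proof -
    define P where "P = x ` (I - {i})"
    have "x ` S i \<subseteq> {y\<in>P. card {w\<in>P - {y}. dist y w < dist y (x i)} < k}"
    proof clarify
      fix j assume j: "j \<in> S i"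
      then have jI: "j \<in> I" "j \<noteq> i" by (auto simp: S_def)
      have "card {w\<in>x ` (I - {j}) - {x i}. dist (x j) w < dist (x j) (x i)} < k"
        using j i jI k(1) A by (intro knn_dist_remove(4)) (auto simp: S_def)
      moreover have "x ` (I - {j}) - {x i} = P - {x j}"
        using img[OF i, of j] img[OF jI(1), of i] by (simp add: P_def Diff_insert2 [symmetric] insert_commute)
      ultimately show "x j \<in> P \<and> card {w\<in>P - {x j}. dist (x j) w < dist (x j) (x i)} < k"
        using jI by (auto simp: P_def)
    qed
    then have "card (x ` S i) \<le> card {y\<in>P. card {w\<in>P - {y}. dist y w < dist y (x i)} < k}"
      using I by (intro card_mono) (auto simp: P_def)
    also have "\<dots> \<le> K"
      using I inj i by (intro K) (auto simp: P_def inj_on_def)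
    finally show ?thesis
      using inj by (subst (asm) card_image) (auto simp: S_def intro: inj_on_subset)
  qed
  have cardT: "card {i\<in>I. j \<in> S i} \<le> k" if j: "j \<in> I" for j
  proof -
    have "x ` {i\<in>I. j \<in> S i} \<subseteq> {z\<in>x ` (I - {j}). knn_dist k (x j) (x ` (I - {j}) - {z})
        \<noteq> knn_dist k (x j) (x ` (I - {j}))}"
      by (auto simp: S_def)
    then have "card (x ` {i\<in>I. j \<in> S i}) \<le> card {z\<in>x ` (I - {j}).
        knn_dist k (x j) (x ` (I - {j}) - {z}) \<noteq> knn_dist k (x j) (x ` (I - {j}))}"
      using I by (intro card_mono) auto
    also have "\<dots> \<le> k"
      using A[OF j] k by (intro card_knn_dist_change_le) auto
    finally show ?thesis
      using inj by (subst (asm) card_image) (auto intro: inj_on_subset)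
  qed
  have step: "(knn_sum k h I x - knn_sum k h (I - {i}) x)\<^sup>2
      \<le> 2 * (Y i)\<^sup>2 + 4 * real K * (\<Sum>j\<in>S i. G j)" if i: "i \<in> I" for i
  proof -
    have fS: "finite (S i)" using I by (simp add: S_def)
    have "knn_sum k h I x - knn_sum k h (I - {i}) x = Y i + (\<Sum>j\<in>I - {i}. Y j - Z i j)"
      unfolding knn_sum_def Y_def[symmetric] Z_def[symmetric]
      using I i by (simp add: sum.remove sum_subtractf)
    also have "(\<Sum>j\<in>I - {i}. Y j - Z i j) = (\<Sum>j\<in>S i. Y j - Z i j)"
      using I img[OF i] by (intro sum.mono_neutral_right) (auto simp: S_def Y_def Z_def)
    also have "\<dots> = (\<Sum>j\<in>S i. Y j - Yt j)"
      using ZS[OF i] by simp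
    finally have eq: "knn_sum k h I x - knn_sum k h (I - {i}) x = Y i + (\<Sum>j\<in>S i. Y j - Yt j)" .
    have sq: "(s + t)\<^sup>2 \<le> 2 * s\<^sup>2 + 2 * t\<^sup>2" "(s - t)\<^sup>2 \<le> 2 * (s\<^sup>2 + t\<^sup>2)" for s t :: real
      using zero_le_power2[of "s - t"] zero_le_power2[of "s + t"]
      by (auto simp: power2_eq_square algebra_simps)
    have "(\<Sum>j\<in>S i. Y j - Yt j)\<^sup>2 \<le> (\<Sum>j\<in>S i. (Y j - Yt j)\<^sup>2) * real (card (S i))"
      by (rule sum_squared_le_sum_of_squares)
    also have "\<dots> \<le> (\<Sum>j\<in>S i. 2 * G j) * real K"
      unfolding G_def using cardS[OF i]
      by (intro mult_mono sum_mono sq(2)) (auto intro: sum_nonneg)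
    finally have "(\<Sum>j\<in>S i. Y j - Yt j)\<^sup>2 \<le> (\<Sum>j\<in>S i. 2 * G j) * real K" .
    then show ?thesis
      unfolding eq using sq(1)[of "Y i" "\<Sum>j\<in>S i. Y j - Yt j"]
      by (simp add: sum_distrib_left[symmetric] sum_distrib_right[symmetric] algebra_simps)
  qed
  have "(\<Sum>i\<in>I. \<Sum>j\<in>S i. G j) = (\<Sum>i\<in>I. \<Sum>j\<in>{j\<in>I. j \<in> S i}. G j)"
    by (intro sum.cong) (auto simp: S_def)
  also have "\<dots> = (\<Sum>j\<in>I. \<Sum>i\<in>{i\<in>I. j \<in> S i}. G j)"
    using I by (rule sum.swap_restrict[OF _ I])
  also have "\<dots> = (\<Sum>j\<in>I. real (card {i\<in>I. j \<in> S i}) * G j)"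
    by simp
  also have "\<dots> \<le> (\<Sum>j\<in>I. real k * G j)"
    using cardT by (intro sum_mono mult_right_mono) (auto simp: G_def)
  finally have swap: "(\<Sum>i\<in>I. \<Sum>j\<in>S i. G j) \<le> real k * (\<Sum>j\<in>I. G j)"
    by (simp add: sum_distrib_left)
  have "(\<Sum>i\<in>I. (knn_sum k h I x - knn_sum k h (I - {i}) x)\<^sup>2)
      \<le> (\<Sum>i\<in>I. 2 * (Y i)\<^sup>2 + 4 * real K * (\<Sum>j\<in>S i. G j))"
    by (intro sum_mono step)
  also have "\<dots> = 2 * (\<Sum>i\<in>I. (Y i)\<^sup>2) + 4 * real K * (\<Sum>i\<in>I. \<Sum>j\<in>S i. G j)"
    by (simp add: sum.distrib sum_distrib_left)
  also have "\<dots> \<le> 2 * (\<Sum>i\<in>I. G i) + 4 * real K * (real k * (\<Sum>j\<in>I. G j))"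
    by (intro add_mono mult_left_mono sum_mono swap) (auto simp: G_def)
  also have "\<dots> = (2 + 4 * real K * real k) * (\<Sum>j\<in>I. G j)"
    by (simp add: algebra_simps)
  finally show ?thesis by (simp add: G_def Y_def Yt_def)
qed

section \<open>The Efron-Stein inequality\<close>

text \<open>The mean is the best constant predictor in mean square, so replacing it by \<open>s\<close> only enlarges
  the first term of the bias-variance decomposition. The nonnegative integral makes the inequality
  valid for every measurable \<open>h\<close>: both sides are infinite when \<open>h\<close> is not square integrable.\<close>

lemma (in prob_space) nn_integral_square_split_le:
  fixes h :: "'a \<Rightarrow> real"
  assumes [measurable]: "h \<in> borel_measurable M"
  shows "(\<integral>\<^sup>+x. ennreal ((h x - c)\<^sup>2) \<partial>M)
    \<le> (\<integral>\<^sup>+x. ennreal ((h x - s)\<^sup>2) \<partial>M) + ennreal (((\<integral>x. h x \<partial>M) - c)\<^sup>2)"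
proof (cases "integrable M (\<lambda>x. (h x - s)\<^sup>2)")
  case True
  have "integrable M (\<lambda>x. h x - s)"
    by (rule square_integrable_imp_integrable) (use True in auto)
  then have h: "integrable M h"
    using Bochner_Integration.integrable_add[of M "\<lambda>x. h x - s" "\<lambda>x. s"] by simp
  define g where "g = (\<integral>x. h x \<partial>M)"
  have "(\<lambda>x. (h x - c)\<^sup>2) = (\<lambda>x. (h x - s)\<^sup>2 + 2 * (s - c) * (h x - s) + (s - c)\<^sup>2)"
    by (rule ext) algebra
  moreover have "has_bochner_integral M (\<lambda>x. (h x - s)\<^sup>2 + 2 * (s - c) * (h x - s) + (s - c)\<^sup>2)
      ((\<integral>x. (h x - s)\<^sup>2 \<partial>M) + 2 * (s - c) * (g - s) + (s - c)\<^sup>2)"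
    unfolding has_bochner_integral_iff using True h by (simp add: g_def prob_space)
  ultimately have hb: "has_bochner_integral M (\<lambda>x. (h x - c)\<^sup>2)
      ((\<integral>x. (h x - s)\<^sup>2 \<partial>M) + 2 * (s - c) * (g - s) + (s - c)\<^sup>2)"
    by simp
  have "(\<integral>x. (h x - s)\<^sup>2 \<partial>M) + 2 * (s - c) * (g - s) + (s - c)\<^sup>2
      \<le> (\<integral>x. (h x - s)\<^sup>2 \<partial>M) + (g - c)\<^sup>2"
  proof -
    have "(g - c)\<^sup>2 - (2 * (s - c) * (g - s) + (s - c)\<^sup>2) = (g - s)\<^sup>2" by algebra
    then show ?thesis using zero_le_power2[of "g - s"] by linarith
  qed
  then have "(\<integral>\<^sup>+x. ennreal ((h x - c)\<^sup>2) \<partial>M) \<le> ennreal ((\<integral>x. (h x - s)\<^sup>2 \<partial>M) + (g - c)\<^sup>2)"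
    using hb by (subst nn_integral_eq_integral)
      (auto simp: has_bochner_integral_iff simp del: ennreal_plus intro!: ennreal_leI)
  also have "\<dots> = (\<integral>\<^sup>+x. ennreal ((h x - s)\<^sup>2) \<partial>M) + ennreal ((g - c)\<^sup>2)"
    using True by (subst nn_integral_eq_integral) (auto simp: ennreal_plus)
  finally show ?thesis by (simp add: g_def)
next
  case False
  then have "(\<integral>\<^sup>+x. ennreal ((h x - s)\<^sup>2) \<partial>M) = \<infinity>"
    by (simp add: integrable_iff_bounded less_top[symmetric])
  then show ?thesis by simp
qed

lemma (in prob_space) square_integral_le_nn_integral:
  fixes h :: "'a \<Rightarrow> real"
  assumes "integrable M h"
  shows "ennreal ((\<integral>x. h x \<partial>M)\<^sup>2) \<le> (\<integral>\<^sup>+x. ennreal ((h x)\<^sup>2) \<partial>M)"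
proof (cases "integrable M (\<lambda>x. (h x)\<^sup>2)")
  case True
  have "(\<integral>x. h x \<partial>M)\<^sup>2 \<le> (\<integral>x. (h x)\<^sup>2 \<partial>M)"
    using variance_eq[OF assms True] variance_positive[of h] by simp
  then show ?thesis
    using True by (simp add: nn_integral_eq_integral)
next
  case False
  then have "(\<integral>\<^sup>+x. ennreal ((h x)\<^sup>2) \<partial>M) = \<infinity>"
    using assms by (simp add: integrable_iff_bounded less_top[symmetric])
  then show ?thesis by simp
qed

text \<open>Induction on the index set. With \<open>g y\<close> the mean of \<open>T\<close> over the new coordinate, the conditional
  variance given the other coordinates is at most the mean square distance to \<open>T' i\<close>, which is constant in
  that coordinate; the rest is the variance of \<open>g\<close>. The averages of the remaining \<open>T' j\<close>
  are admissible for \<open>g\<close>, and Jensen's inequality compares the errors.\<close>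

lemma Efron_Stein:
  fixes \<mu> :: "'i \<Rightarrow> 'b measure" and T :: "('i \<Rightarrow> 'b) \<Rightarrow> real"
  assumes \<mu>: "\<And>i. prob_space (\<mu> i)" and I: "finite I"
    and T: "integrable (PiM I \<mu>) T" and T': "\<And>i. i \<in> I \<Longrightarrow> integrable (PiM I \<mu>) (T' i)"
    and dep: "\<And>i x z. i \<in> I \<Longrightarrow> T' i (x(i := z)) = T' i x"
  shows "(\<integral>\<^sup>+x. ennreal ((T x - (\<integral>y. T y \<partial>PiM I \<mu>))\<^sup>2) \<partial>PiM I \<mu>)
    \<le> (\<Sum>i\<in>I. \<integral>\<^sup>+x. ennreal ((T x - T' i x)\<^sup>2) \<partial>PiM I \<mu>)"
  using I T T' dep
proof (induction I arbitrary: T T')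
  case empty
  show ?case
    by (simp add: PiM_empty lebesgue_integral_count_space_finite nn_integral_count_space_finite)
next
  case (insert i I)
  interpret S: product_sigma_finite \<mu>
    using \<mu> by (simp add: product_sigma_finite_def prob_space_imp_sigma_finite)
  interpret i: prob_space "\<mu> i" by (rule \<mu>)
  interpret I: prob_space "PiM I \<mu>" using \<mu> by (rule prob_space_PiM)
  interpret iI: pair_prob_space "\<mu> i" "PiM I \<mu>" ..
  have upd [measurable]: "(\<lambda>(z, y). y(i := z)) \<in> \<mu> i \<Otimes>\<^sub>M PiM I \<mu> \<rightarrow>\<^sub>M PiM (insert i I) \<mu>"
    by measurable
  have pair: "distr (\<mu> i \<Otimes>\<^sub>M PiM I \<mu>) (PiM (insert i I) \<mu>) (\<lambda>(z, y). y(i := z)) = PiM (insert i I) \<mu>"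
    using \<mu> insert.hyps by (intro distr_pair_PiM_eq_PiM) auto
  have int: "integrable (\<mu> i \<Otimes>\<^sub>M PiM I \<mu>) (\<lambda>(z, y). U (y(i := z)))"
    if "integrable (PiM (insert i I) \<mu>) U" for U :: "('i \<Rightarrow> 'b) \<Rightarrow> real"
    using integrable_distr[OF upd, of U] that unfolding pair by (simp add: case_prod_beta')
  have nn: "(\<integral>\<^sup>+x. U x \<partial>PiM (insert i I) \<mu>) = (\<integral>\<^sup>+y. \<integral>\<^sup>+z. U (y(i := z)) \<partial>\<mu> i \<partial>PiM I \<mu>)"
    if "U \<in> borel_measurable (PiM (insert i I) \<mu>)" for U :: "('i \<Rightarrow> 'b) \<Rightarrow> ennreal"
    using insert.hyps that by (rule S.product_nn_integral_insert)
  define g where "g U y = (\<integral>z. U (y(i := z)) \<partial>\<mu> i)" for U :: "('i \<Rightarrow> 'b) \<Rightarrow> real" and y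
  have g: "integrable (PiM I \<mu>) (g U)" if "integrable (PiM (insert i I) \<mu>) U" for U
    unfolding g_def using int[OF that] by (rule iI.integrable_snd)
  have sect: "AE y in PiM I \<mu>. integrable (\<mu> i) (\<lambda>z. U (y(i := z)))"
    if "integrable (PiM (insert i I) \<mu>) U" for U :: "('i \<Rightarrow> 'b) \<Rightarrow> real"
    using int[OF that] by (rule iI.AE_integrable_snd)
  note [measurable] = insert.prems(1)[THEN borel_measurable_integrable]
  have T'_meas: "T' j \<in> borel_measurable (PiM (insert i I) \<mu>)" if "j \<in> insert i I" for j
    using insert.prems(2)[OF that] by (rule borel_measurable_integrable)
  have [measurable]: "T' i \<in> borel_measurable (PiM (insert i I) \<mu>)" by (rule T'_meas) simp
  have sec [measurable]: "(\<lambda>z. y(i := z)) \<in> \<mu> i \<rightarrow>\<^sub>M PiM (insert i I) \<mu>"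
    if "y \<in> space (PiM I \<mu>)" for y
    using that by (intro measurable_fun_upd[where J = I]) auto
  have upd' [measurable]: "(\<lambda>(y, z). y(i := z)) \<in> PiM I \<mu> \<Otimes>\<^sub>M \<mu> i \<rightarrow>\<^sub>M PiM (insert i I) \<mu>"
    by (rule measurable_add_dim)
  define c where "c = (\<integral>x. T x \<partial>PiM (insert i I) \<mu>)"
  have c: "c = (\<integral>y. g T y \<partial>PiM I \<mu>)"
    unfolding c_def g_def using insert.hyps insert.prems(1) by (rule S.product_integral_insert)
  have [measurable]: "g T \<in> borel_measurable (PiM I \<mu>)"
    using g[OF insert.prems(1)] by (rule borel_measurable_integrable)
  have "(\<integral>\<^sup>+x. ennreal ((T x - c)\<^sup>2) \<partial>PiM (insert i I) \<mu>)
      = (\<integral>\<^sup>+y. \<integral>\<^sup>+z. ennreal ((T (y(i := z)) - c)\<^sup>2) \<partial>\<mu> i \<partial>PiM I \<mu>)"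
    by (rule nn) measurable
  also have "\<dots> \<le> (\<integral>\<^sup>+y. (\<integral>\<^sup>+z. ennreal ((T (y(i := z)) - T' i (y(i := z)))\<^sup>2) \<partial>\<mu> i)
      + ennreal ((g T y - c)\<^sup>2) \<partial>PiM I \<mu>)"
  proof (rule nn_integral_mono)
    fix y assume "y \<in> space (PiM I \<mu>)"
    then have "(\<lambda>z. T (y(i := z))) \<in> borel_measurable (\<mu> i)"
      by (intro measurable_compose[OF sec]) auto
    then     show "(\<integral>\<^sup>+z. ennreal ((T (y(i := z)) - c)\<^sup>2) \<partial>\<mu> i)
        \<le> (\<integral>\<^sup>+z. ennreal ((T (y(i := z)) - T' i (y(i := z)))\<^sup>2) \<partial>\<mu> i) + ennreal ((g T y - c)\<^sup>2)"
      unfolding g_def insert.prems(3)[OF insertI1] by (rule i.nn_integral_square_split_le)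
  qed
  also have "\<dots> = (\<integral>\<^sup>+y. \<integral>\<^sup>+z. ennreal ((T (y(i := z)) - T' i (y(i := z)))\<^sup>2) \<partial>\<mu> i \<partial>PiM I \<mu>)
      + (\<integral>\<^sup>+y. ennreal ((g T y - c)\<^sup>2) \<partial>PiM I \<mu>)"
    by (rule nn_integral_add) measurable
  also have "(\<integral>\<^sup>+y. \<integral>\<^sup>+z. ennreal ((T (y(i := z)) - T' i (y(i := z)))\<^sup>2) \<partial>\<mu> i \<partial>PiM I \<mu>)
      = (\<integral>\<^sup>+x. ennreal ((T x - T' i x)\<^sup>2) \<partial>PiM (insert i I) \<mu>)"
    by (rule nn[symmetric]) measurable
  finally have total: "(\<integral>\<^sup>+x. ennreal ((T x - c)\<^sup>2) \<partial>PiM (insert i I) \<mu>)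
      \<le> (\<integral>\<^sup>+x. ennreal ((T x - T' i x)\<^sup>2) \<partial>PiM (insert i I) \<mu>)
        + (\<integral>\<^sup>+y. ennreal ((g T y - c)\<^sup>2) \<partial>PiM I \<mu>)" .
  have "(\<integral>\<^sup>+y. ennreal ((g T y - c)\<^sup>2) \<partial>PiM I \<mu>)
      \<le> (\<Sum>j\<in>I. \<integral>\<^sup>+y. ennreal ((g T y - g (T' j) y)\<^sup>2) \<partial>PiM I \<mu>)"
    unfolding c
  proof (rule insert.IH)
    show "integrable (PiM I \<mu>) (g T)" by (rule g) fact
    show "integrable (PiM I \<mu>) (g (T' j))" if "j \<in> I" for j
      by (rule g) (use insert.prems(2) that in auto)
    show "g (T' j) (x(j := z)) = g (T' j) x" if "j \<in> I" for j x z
    proof -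
      have "j \<noteq> i" using that insert.hyps by auto
      then have "T' j (x(j := z, i := w)) = T' j (x(i := w))" for w
        using insert.prems(3)[of j "x(i := w)" z] that unfolding fun_upd_twist[OF \<open>j \<noteq> i\<close>] by blast
      then show ?thesis unfolding g_def by (simp only:)
    qed
  qed
  also have "(\<Sum>j\<in>I. \<integral>\<^sup>+y. ennreal ((g T y - g (T' j) y)\<^sup>2) \<partial>PiM I \<mu>)
      \<le> (\<Sum>j\<in>I. \<integral>\<^sup>+x. ennreal ((T x - T' j x)\<^sup>2) \<partial>PiM (insert i I) \<mu>)"
  proof (rule sum_mono)
    fix j assume j: "j \<in> I"
    then have T'j: "integrable (PiM (insert i I) \<mu>) (T' j)" using insert.prems(2) by auto
    have [measurable]: "T' j \<in> borel_measurable (PiM (insert i I) \<mu>)" using j by (intro T'_meas) simp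
    have "(\<integral>\<^sup>+y. ennreal ((g T y - g (T' j) y)\<^sup>2) \<partial>PiM I \<mu>)
        \<le> (\<integral>\<^sup>+y. \<integral>\<^sup>+z. ennreal ((T (y(i := z)) - T' j (y(i := z)))\<^sup>2) \<partial>\<mu> i \<partial>PiM I \<mu>)"
    proof (rule nn_integral_mono_AE)
      show "AE y in PiM I \<mu>. ennreal ((g T y - g (T' j) y)\<^sup>2)
          \<le> (\<integral>\<^sup>+z. ennreal ((T (y(i := z)) - T' j (y(i := z)))\<^sup>2) \<partial>\<mu> i)"
        using sect[OF insert.prems(1)] sect[OF T'j]
      proof eventually_elim
        case (elim y)
        then have "g T y - g (T' j) y = (\<integral>z. T (y(i := z)) - T' j (y(i := z)) \<partial>\<mu> i)"
          unfolding g_def by (rule Bochner_Integration.integral_diff[symmetric])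
        then show ?case
          using i.square_integral_le_nn_integral[OF Bochner_Integration.integrable_diff[OF elim]]
          by (simp only:)
      qed
    qed
    also have "\<dots> = (\<integral>\<^sup>+x. ennreal ((T x - T' j x)\<^sup>2) \<partial>PiM (insert i I) \<mu>)"
      by (rule nn[symmetric]) measurable
    finally show "(\<integral>\<^sup>+y. ennreal ((g T y - g (T' j) y)\<^sup>2) \<partial>PiM I \<mu>)
        \<le> (\<integral>\<^sup>+x. ennreal ((T x - T' j x)\<^sup>2) \<partial>PiM (insert i I) \<mu>)" .
  qed
  finally have "(\<integral>\<^sup>+y. ennreal ((g T y - c)\<^sup>2) \<partial>PiM I \<mu>)
      \<le> (\<Sum>j\<in>I. \<integral>\<^sup>+x. ennreal ((T x - T' j x)\<^sup>2) \<partial>PiM (insert i I) \<mu>)" .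
  from order_trans[OF total add_left_mono[OF this]] show ?case
    using insert.hyps unfolding c_def by (simp only: sum.insert not_False_eq_True)
qed

section \<open>Measurability and absence of coinciding points\<close>

text \<open>Phrased with index sets \<open>L\<close>, a lower bound on the number of distinct values becomes a finite combination of
  equalities between coordinates and is therefore measurable.\<close>

lemma le_card_image_filter_iff:
  assumes "finite J"
  shows "c \<le> card {y\<in>g ` J. P y} \<longleftrightarrow> (\<exists>L\<in>Pow J. card L = c \<and> inj_on g L \<and> (\<forall>j\<in>L. P (g j)))"
proof
  assume "c \<le> card {y\<in>g ` J. P y}"
  then obtain T where T: "T \<subseteq> {y\<in>g ` J. P y}" "card T = c"
    by (meson obtain_subset_with_card_n)
  then have "T \<subseteq> g ` J" by auto
  then obtain L where "L \<subseteq> J" "inj_on g L" "T = g ` L"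
    unfolding subset_image_inj by blast
  with T show "\<exists>L\<in>Pow J. card L = c \<and> inj_on g L \<and> (\<forall>j\<in>L. P (g j))"
    by (intro bexI[of _ L]) (auto simp: card_image)
next
  assume "\<exists>L\<in>Pow J. card L = c \<and> inj_on g L \<and> (\<forall>j\<in>L. P (g j))"
  then obtain L where L: "L \<subseteq> J" "card L = c" "inj_on g L" "\<forall>j\<in>L. P (g j)" by auto
  have "card (g ` L) \<le> card {y\<in>g ` J. P y}"
    using L assms by (intro card_mono) auto
  then show "c \<le> card {y\<in>g ` J. P y}" using L by (simp add: card_image)
qed

lemma nth_beyond_length: "length xs \<le> n \<Longrightarrow> xs ! n = [] ! (n - length xs)"
proof (induction xs arbitrary: n)
  case (Cons x xs)
  then show ?case by (cases n) auto
qed simp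

lemma knn_dist_beyond_card:
  assumes "card A < k"
  shows "knn_dist k x A = [] ! (k - 1 - card A)"
  unfolding knn_dist_def using assms
  by (subst nth_beyond_length) (auto simp: length_sorted_list_of_multiset)

text \<open>Coinciding sample points shrink the image set, possibly below \<open>k\<close> elements, and the list lookup
  then runs past the end. Such lookups depend only on the overshoot, so the distance is still a
  function of finitely many measurable conditions: the cardinality of the image and, when that is at least
  \<open>k\<close>, the counting criterion for the distance.\<close>

lemma borel_measurable_knn_dist:
  fixes Y :: "'i \<Rightarrow> 'w \<Rightarrow> 'a::euclidean_space"
  assumes J: "finite J" and k: "1 \<le> k" and [measurable]: "Z \<in> borel_measurable N"
    and Y: "\<And>j. j \<in> J \<Longrightarrow> Y j \<in> borel_measurable N"
  shows "(\<lambda>w. knn_dist k (Z w) ((\<lambda>j. Y j w) ` J)) \<in> borel_measurable N"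
proof (rule borel_measurableI_le)
  fix r :: real
  define A where "A w = (\<lambda>j. Y j w) ` J" for w
  have near: "Measurable.pred N (\<lambda>w. c \<le> card {y\<in>A w. Q \<or> dist (Z w) y \<le> r})" for c Q
  proof -
    have pair: "Measurable.pred N (\<lambda>w. j = l \<or> Y j w \<noteq> Y l w)" if "j \<in> J" "l \<in> J" for j l
    proof -
      note [measurable] = Y[OF that(1)] Y[OF that(2)]
      show ?thesis by measurable
    qed
    have single: "Measurable.pred N (\<lambda>w. Q \<or> dist (Z w) (Y j w) \<le> r)" if "j \<in> J" for j
    proof -
      note [measurable] = Y[OF that]
      show ?thesis by measurable
    qed
    have "Measurable.pred N (\<lambda>w. card L = c \<and> (\<forall>j\<in>L. \<forall>l\<in>L. j = l \<or> Y j w \<noteq> Y l w)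
        \<and> (\<forall>j\<in>L. Q \<or> dist (Z w) (Y j w) \<le> r))" if "L \<in> Pow J" for L
    proof -
      have L: "finite L" "L \<subseteq> J" using that J finite_subset by auto
      show ?thesis
        by (intro pred_intros_logic pred_intros_finite L(1) pair single) (use L(2) in auto)
    qed
    then have "Measurable.pred N (\<lambda>w. \<exists>L\<in>Pow J. card L = c
        \<and> (\<forall>j\<in>L. \<forall>l\<in>L. j = l \<or> Y j w \<noteq> Y l w) \<and> (\<forall>j\<in>L. Q \<or> dist (Z w) (Y j w) \<le> r))"
      by (rule pred_intros_finite(4)[OF finite_Pow_iff[THEN iffD2, OF J]])
    moreover have "c \<le> card {y\<in>A w. Q \<or> dist (Z w) y \<le> r} \<longleftrightarrow> (\<exists>L\<in>Pow J. card L = c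
        \<and> (\<forall>j\<in>L. \<forall>l\<in>L. j = l \<or> Y j w \<noteq> Y l w) \<and> (\<forall>j\<in>L. Q \<or> dist (Z w) (Y j w) \<le> r))" for w
    proof -
      have "inj_on (\<lambda>j. Y j w) L \<longleftrightarrow> (\<forall>j\<in>L. \<forall>l\<in>L. j = l \<or> Y j w \<noteq> Y l w)" for L
        by (auto simp: inj_on_def)
      then show ?thesis unfolding A_def le_card_image_filter_iff[OF J] by (simp only:)
    qed
    ultimately show ?thesis by simp
  qed
  have card_A: "Measurable.pred N (\<lambda>w. card (A w) = c)" for c
  proof -
    have "card (A w) = c \<longleftrightarrow> c \<le> card {y\<in>A w. True \<or> dist (Z w) y \<le> r}
        \<and> \<not> c + 1 \<le> card {y\<in>A w. True \<or> dist (Z w) y \<le> r}" for w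
      by auto
    then show ?thesis using near[of c True] near[of "c + 1" True]
      by (simp only:) (intro pred_intros_logic)
  qed
  have "knn_dist k (Z w) (A w) \<le> r \<longleftrightarrow> (\<exists>c\<in>{..card J}. card (A w) = c \<and>
      (if k \<le> c then k \<le> card {y\<in>A w. False \<or> dist (Z w) y \<le> r}
       else ([] :: real list) ! (k - 1 - c) \<le> r))" for w
  proof -
    have "card (A w) \<le> card J" "finite (A w)" using J by (auto simp: A_def card_image_le)
    then show ?thesis
      using k by (cases "k \<le> card (A w)") (auto simp: knn_dist_le_iff knn_dist_beyond_card)
  qed
  moreover have "Measurable.pred N (\<lambda>w. \<exists>c\<in>{..card J}. card (A w) = c \<and>
      (if k \<le> c then k \<le> card {y\<in>A w. False \<or> dist (Z w) y \<le> r}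
       else ([] :: real list) ! (k - 1 - c) \<le> r))"
  proof (intro pred_intros_finite pred_intros_logic card_A)
    fix c
    show "Measurable.pred N (\<lambda>w. if k \<le> c then k \<le> card {y\<in>A w. False \<or> dist (Z w) y \<le> r}
        else ([] :: real list) ! (k - 1 - c) \<le> r)"
      using near[of k False] by (cases "k \<le> c") simp_all
  qed simp
  ultimately show "{w\<in>space N. knn_dist k (Z w) ((\<lambda>j. Y j w) ` J) \<le> r} \<in> sets N"
    by (simp add: A_def[symmetric] pred_def)
qed

lemma AE_PiM_inj_on:
  fixes \<mu> :: "'a::euclidean_space measure"
  assumes "prob_space \<mu>" and [measurable_cong]: "sets \<mu> = sets borel"
    and atomless: "\<And>x. emeasure \<mu> {x} = 0" and I: "finite I"
  shows "AE x in PiM I (\<lambda>_. \<mu>). inj_on x I"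
proof -
  interpret prob_space \<mu> by fact
  interpret S: product_sigma_finite "\<lambda>_. \<mu>"
    by (simp add: product_sigma_finite_def prob_space_imp_sigma_finite assms(1))
  have ne: "AE x in PiM I (\<lambda>_. \<mu>). x i \<noteq> x j" if ij: "i \<in> I" "j \<in> I" "i \<noteq> j" for i j
  proof -
    define J where "J = I - {i}"
    have J: "I = insert i J" "finite J" "i \<notin> J" "j \<in> J" using ij I by (auto simp: J_def)
    note [measurable] = J(4)
    have meas: "{x\<in>space (PiM I (\<lambda>_. \<mu>)). x i = x j} \<in> sets (PiM I (\<lambda>_. \<mu>))"
      using ij by measurable
    have "emeasure (PiM I (\<lambda>_. \<mu>)) {x\<in>space (PiM I (\<lambda>_. \<mu>)). x i = x j}
        = (\<integral>\<^sup>+x. indicator {x\<in>space (PiM I (\<lambda>_. \<mu>)). x i = x j} x \<partial>PiM I (\<lambda>_. \<mu>))"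
      using meas by simp
    also have "\<dots> = (\<integral>\<^sup>+y. \<integral>\<^sup>+z. indicator {x\<in>space (PiM I (\<lambda>_. \<mu>)). x i = x j} (y(i := z)) \<partial>\<mu>
        \<partial>PiM J (\<lambda>_. \<mu>))"
      using meas J(2,3) unfolding J(1) by (intro S.product_nn_integral_insert) auto
    also have "\<dots> \<le> (\<integral>\<^sup>+y. \<integral>\<^sup>+z. indicator {y j} z \<partial>\<mu> \<partial>PiM J (\<lambda>_. \<mu>))"
      using ij(3) by (intro nn_integral_mono) (auto split: split_indicator)
    also have "\<dots> = 0" using atomless by simp
    finally show ?thesis
      using meas by (subst AE_iff_measurable[OF meas]) auto
  qed
  have "AE x in PiM I (\<lambda>_. \<mu>). \<forall>i\<in>I. \<forall>j\<in>I. i \<noteq> j \<longrightarrow> x i \<noteq> x j"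
    using ne by (intro AE_finite_allI I) (auto intro: AE_I2)
  then show ?thesis by eventually_elim (auto simp: inj_on_def)
qed

section \<open>Tails of nearest neighbour volumes\<close>

lemma card_Collect_subset_le_pow:
  assumes "finite J"
  shows "card {L. L \<subseteq> J \<and> card L = k} \<le> card J ^ k"
proof (cases "k \<le> card J")
  case True
  then show ?thesis using n_subsets[OF assms, of k] binomial_le_pow by metis
next
  case False
  then have "{L. L \<subseteq> J \<and> card L = k} = {}"
    using card_mono[OF assms] by auto
  then show ?thesis by (simp only: card.empty)
qed

text \<open>The hypotheses on the density enter only through the mass of balls centred in a set \<open>S\<close> of full
  measure. The lower bound stops at the radius \<open>D\<close>, which bounds the diameter of \<open>S\<close>: neighbour
  distances between points of \<open>S\<close> are never larger.\<close>

locale knn_sampling = prob_space \<mu> for \<mu> :: "'a::euclidean_space measure" +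
  fixes S :: "'a set" and A c D :: real
  assumes sets_mu [measurable_cong]: "sets \<mu> = sets borel"
    and A_pos: "0 < A" and c_pos: "0 < c"
    and AE_S: "AE x in \<mu>. x \<in> S"
    and dist_S: "\<And>x y. x \<in> S \<Longrightarrow> y \<in> S \<Longrightarrow> dist x y \<le> D"
    and ball_upper: "\<And>x \<rho>. 0 \<le> \<rho> \<Longrightarrow> measure \<mu> (cball x \<rho>) \<le> A * \<rho> ^ DIM('a)"
    and ball_lower: "\<And>x \<rho>. x \<in> S \<Longrightarrow> 0 \<le> \<rho> \<Longrightarrow> \<rho> \<le> D \<Longrightarrow> c * \<rho> ^ DIM('a) \<le> measure \<mu> (cball x \<rho>)"
begin

sublocale sample: product_sigma_finite "\<lambda>_. \<mu>"
  by (simp add: product_sigma_finite_def sigma_finite_measure_axioms)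

lemma prob_space_sample: "prob_space (PiM I (\<lambda>_. \<mu>))"
  by (intro prob_space_PiM prob_space_axioms)

lemma emeasure_singleton: "emeasure \<mu> {x} = 0"
proof -
  have "measure \<mu> {x} = 0"
    using ball_upper[of 0 x] by (simp add: zero_power order_antisym)
  then show ?thesis by (simp add: emeasure_eq_measure)
qed

text \<open>Union bound over the \<open>k\<close>-element subsets of indices whose points all fall in the ball.\<close>

lemma prob_many_near_le:
  assumes J: "finite J" and \<rho>: "0 \<le> \<rho>"
  shows "(\<integral>\<^sup>+y. indicator {y. k \<le> card {j\<in>J. dist x (y j) \<le> \<rho>}} y \<partial>PiM J (\<lambda>_. \<mu>))
    \<le> ennreal ((card J * (A * \<rho> ^ DIM('a))) ^ k)"
proof -
  define q where "q = measure \<mu> (cball x \<rho>)"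
  define F where "F = {L. L \<subseteq> J \<and> card L = k}"
  have fF: "finite F" using J by (simp add: F_def)
  define e where "e L j z = (if j \<in> L then indicator (cball x \<rho>) z else 1 :: ennreal)"
    for L :: "'b set" and j z
  have e_meas: "e L j \<in> borel_measurable \<mu>" for L j
    unfolding e_def by (cases "j \<in> L") (auto intro!: borel_measurable_indicator simp: sets_mu)
  have "(\<integral>\<^sup>+y. indicator {y. k \<le> card {j\<in>J. dist x (y j) \<le> \<rho>}} y \<partial>PiM J (\<lambda>_. \<mu>))
      \<le> (\<integral>\<^sup>+y. (\<Sum>L\<in>F. \<Prod>j\<in>J. e L j (y j)) \<partial>PiM J (\<lambda>_. \<mu>))"
  proof (rule nn_integral_mono)
    fix y
    show "indicator {y. k \<le> card {j\<in>J. dist x (y j) \<le> \<rho>}} y \<le> (\<Sum>L\<in>F. \<Prod>j\<in>J. e L j (y j))"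
    proof (cases "k \<le> card {j\<in>J. dist x (y j) \<le> \<rho>}")
      case True
      then obtain L where L: "L \<subseteq> {j\<in>J. dist x (y j) \<le> \<rho>}" "card L = k"
        by (meson obtain_subset_with_card_n)
      then have "L \<in> F" by (auto simp: F_def)
      have "1 = (\<Prod>j\<in>J. e L j (y j))"
        using L by (intro prod.neutral[symmetric]) (auto simp: e_def)
      also have "\<dots> \<le> (\<Sum>L\<in>F. \<Prod>j\<in>J. e L j (y j))"
        using fF \<open>L \<in> F\<close> by (intro member_le_sum) auto
      finally show ?thesis using True by simp
    qed simp
  qed
  also have "\<dots> = (\<Sum>L\<in>F. \<integral>\<^sup>+y. (\<Prod>j\<in>J. e L j (y j)) \<partial>PiM J (\<lambda>_. \<mu>))"
  proof (rule nn_integral_sum)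
    fix L
    show "(\<lambda>y. \<Prod>j\<in>J. e L j (y j)) \<in> borel_measurable (PiM J (\<lambda>_. \<mu>))"
      by (intro borel_measurable_prod_ennreal measurable_PiM_component_rev e_meas)
  qed
  also have "\<dots> = (\<Sum>L\<in>F. ennreal (q ^ k))"
  proof (rule sum.cong[OF refl])
    fix L assume L: "L \<in> F"
    then have LJ: "L \<subseteq> J" "card L = k" by (auto simp: F_def)
    have int: "integral\<^sup>N \<mu> (e L j) = (if j \<in> L then ennreal q else 1)" for j
      by (simp add: e_def[abs_def] sets_mu prob_space emeasure_eq_measure q_def)
    have "(\<integral>\<^sup>+y. (\<Prod>j\<in>J. e L j (y j)) \<partial>PiM J (\<lambda>_. \<mu>)) = (\<Prod>j\<in>J. integral\<^sup>N \<mu> (e L j))"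
      by (rule sample.product_nn_integral_prod[OF J e_meas])
    also have "\<dots> = (\<Prod>j\<in>L. ennreal q)"
      unfolding int using J LJ(1) by (simp add: prod.If_cases Int_absorb1)
    also have "\<dots> = ennreal (q ^ k)"
      using LJ(2) by (simp add: ennreal_power q_def)
    finally show "(\<integral>\<^sup>+y. (\<Prod>j\<in>J. e L j (y j)) \<partial>PiM J (\<lambda>_. \<mu>)) = ennreal (q ^ k)" .
  qed
  also have "\<dots> = ennreal (card F * q ^ k)"
    by (simp add: ennreal_of_nat_eq_real_of_nat ennreal_mult q_def)
  also have "\<dots> \<le> ennreal ((card J * (A * \<rho> ^ DIM('a))) ^ k)"
  proof (rule ennreal_leI)
    have "real (card F) * q ^ k \<le> real (card J ^ k) * (A * \<rho> ^ DIM('a)) ^ k"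
      using card_Collect_subset_le_pow[OF J, of k] ball_upper[OF \<rho>, of x]
      by (intro mult_mono power_mono of_nat_mono) (auto simp: F_def q_def)
    then show "real (card F) * q ^ k \<le> (card J * (A * \<rho> ^ DIM('a))) ^ k"
      by (simp add: power_mult_distrib)
  qed
  finally show ?thesis .
qed

text \<open>Chernoff bound: if \<open>N\<close> points fall in the ball, then \<open>N < k\<close> implies \<open>1 \<le> 2\<^sup>k 2\<^sup>-\<^sup>N\<close>, and \<open>2\<^sup>-\<^sup>N\<close> is
  a product of independent factors \<open>e\<close> of mean \<open>1 - q / 2\<close>.\<close>

lemma prob_few_near_le:
  assumes J: "finite J" and x: "x \<in> S" and \<rho>: "0 \<le> \<rho>" "\<rho> \<le> D"
  shows "(\<integral>\<^sup>+y. indicator {y. card {j\<in>J. dist x (y j) \<le> \<rho>} < k} y \<partial>PiM J (\<lambda>_. \<mu>))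
    \<le> ennreal (2 ^ k * exp (- (card J * (c * \<rho> ^ DIM('a)) / 2)))"
proof -
  define q where "q = measure \<mu> (cball x \<rho>)"
  define e where "e z = (if z \<in> cball x \<rho> then 1 / 2 else 1 :: real)" for z
  have [measurable]: "cball x \<rho> \<in> sets borel" by simp
  have e_meas: "(\<lambda>z. ennreal (e z)) \<in> borel_measurable \<mu>"
    unfolding e_def by measurable
  have e_nonneg: "0 \<le> e z" for z by (simp add: e_def)
  have "(\<integral>\<^sup>+y. indicator {y. card {j\<in>J. dist x (y j) \<le> \<rho>} < k} y \<partial>PiM J (\<lambda>_. \<mu>))
      \<le> (\<integral>\<^sup>+y. ennreal (2 ^ k) * (\<Prod>j\<in>J. ennreal (e (y j))) \<partial>PiM J (\<lambda>_. \<mu>))"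
  proof (rule nn_integral_mono)
    fix y
    define N where "N = card {j\<in>J. dist x (y j) \<le> \<rho>}"
    have "(\<Prod>j\<in>J. e (y j)) = (\<Prod>j\<in>{j\<in>J. dist x (y j) \<le> \<rho>}. 1 / 2)"
      unfolding e_def using J by (simp add: prod.If_cases Int_def)
    also have "\<dots> = (1 / 2) ^ N" by (simp add: N_def)
    finally have e_prod: "(\<Prod>j\<in>J. ennreal (e (y j))) = ennreal ((1 / 2) ^ N)"
      by (simp add: prod_ennreal e_nonneg)
    show "indicator {y. card {j\<in>J. dist x (y j) \<le> \<rho>} < k} y
        \<le> ennreal (2 ^ k) * (\<Prod>j\<in>J. ennreal (e (y j)))"
    proof (cases "N < k")
      case True
      have "(1::real) = 2 ^ N * (1 / 2) ^ N" by (simp add: power_divide)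
      also have "\<dots> \<le> 2 ^ k * (1 / 2) ^ N"
        using True by (intro mult_right_mono power_increasing) auto
      finally have "ennreal 1 \<le> ennreal (2 ^ k * (1 / 2) ^ N)" by (rule ennreal_leI)
      then show ?thesis
        using True unfolding e_prod by (simp add: N_def ennreal_mult)
    qed (simp add: N_def)
  qed
  also have "\<dots> = ennreal (2 ^ k) * (\<Prod>j\<in>J. integral\<^sup>N \<mu> (\<lambda>z. ennreal (e z)))"
    using sample.product_nn_integral_prod[OF J e_meas]
    by (subst nn_integral_cmult)
      (auto intro!: borel_measurable_prod_ennreal measurable_PiM_component_rev e_meas)
  also have "integral\<^sup>N \<mu> (\<lambda>z. ennreal (e z)) = ennreal (1 - q / 2)"
  proof -
    have "has_bochner_integral \<mu> (\<lambda>z. 1 - indicator (cball x \<rho>) z / 2 :: real) (1 - q / 2)"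
      by (simp add: has_bochner_integral_iff q_def prob_space emeasure_eq_measure sets_mu)
    moreover have "(\<lambda>z. 1 - indicator (cball x \<rho>) z / 2 :: real) = e"
      by (auto simp: e_def split: split_indicator)
    ultimately show ?thesis
      by (simp add: has_bochner_integral_iff nn_integral_eq_integral e_nonneg)
  qed
  also have "ennreal (2 ^ k) * (\<Prod>j\<in>J. ennreal (1 - q / 2)) = ennreal (2 ^ k * (1 - q / 2) ^ card J)"
  proof -
    have "q \<le> 1" by (simp add: q_def)
    then show ?thesis by (simp add: ennreal_power ennreal_mult)
  qed
  also have "\<dots> \<le> ennreal (2 ^ k * exp (- (card J * (c * \<rho> ^ DIM('a)) / 2)))"
  proof (intro ennreal_leI mult_left_mono)
    have "q \<le> 1" by (simp add: q_def)
    have "(1 - q / 2) ^ card J \<le> exp (- (q / 2)) ^ card J"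
      using exp_ge_add_one_self[of "- (q / 2)"] \<open>q \<le> 1\<close> by (intro power_mono) auto
    also have "\<dots> = exp (- (card J * q / 2))"
      by (simp add: exp_of_nat_mult[symmetric])
    also have "\<dots> \<le> exp (- (card J * (c * \<rho> ^ DIM('a)) / 2))"
      using ball_lower[OF x \<rho>] by (simp add: q_def mult_left_mono)
    finally show "(1 - q / 2) ^ card J \<le> exp (- (card J * (c * \<rho> ^ DIM('a)) / 2))" .
  qed simp
  finally show ?thesis .
qed

end

lemma inj_on_card_near:
  assumes "inj_on x J"
  shows "card {y\<in>x ` J. P y} = card {j\<in>J. P (x j)}"
proof -
  have "{y\<in>x ` J. P y} = x ` {j\<in>J. P (x j)}" by auto
  then show ?thesis using assms by (simp add: card_image inj_on_subset)
qed

context knn_sampling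
begin

lemma AE_sample_inj_on: "finite I \<Longrightarrow> AE x in PiM I (\<lambda>_. \<mu>). inj_on x I"
  by (rule AE_PiM_inj_on[OF prob_space_axioms sets_mu emeasure_singleton])

lemma AE_sample_in_S: "finite I \<Longrightarrow> AE x in PiM I (\<lambda>_. \<mu>). \<forall>j\<in>I. x j \<in> S"
  by (intro AE_finite_allI AE_PiM_component prob_space_axioms AE_S)

lemma measurable_near_count:
  fixes J :: "nat set"
  assumes "finite J" "J \<subseteq> I" "i \<in> I"
  shows "(\<lambda>x. card {j\<in>J. dist (x i) (x j) \<le> \<rho>}) \<in> PiM I (\<lambda>_. \<mu>) \<rightarrow>\<^sub>M count_space UNIV"
proof (rule measurable_card)
  fix j
  note [measurable] = assms(3)
  show "{x\<in>space (PiM I (\<lambda>_. \<mu>)). j \<in> {j\<in>J. dist (x i) (x j) \<le> \<rho>}} \<in> sets (PiM I (\<lambda>_. \<mu>))"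
  proof (cases "j \<in> J")
    case True
    then have [measurable]: "j \<in> I" using assms(2) by auto
    show ?thesis using True by simp
  qed simp
qed

lemma nn_integral_sample_insert:
  fixes J :: "nat set"
  assumes J: "finite J" "i \<notin> J"
    and f: "f \<in> borel_measurable (PiM (insert i J) (\<lambda>_. \<mu>))"
    and le: "\<And>z. z \<in> S \<Longrightarrow> (\<integral>\<^sup>+y. f (y(i := z)) \<partial>PiM J (\<lambda>_. \<mu>)) \<le> B"
  shows "(\<integral>\<^sup>+x. f x \<partial>PiM (insert i J) (\<lambda>_. \<mu>)) \<le> B"
proof -
  have "(\<integral>\<^sup>+x. f x \<partial>PiM (insert i J) (\<lambda>_. \<mu>)) = (\<integral>\<^sup>+z. \<integral>\<^sup>+y. f (y(i := z)) \<partial>PiM J (\<lambda>_. \<mu>) \<partial>\<mu>)"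
    by (rule sample.product_nn_integral_insert_rev[OF J f])
  also have "\<dots> \<le> (\<integral>\<^sup>+z. B \<partial>\<mu>)"
    using AE_S le by (intro nn_integral_mono_AE) auto
  also have "\<dots> = B" by (simp add: emeasure_space_1)
  finally show ?thesis .
qed

text \<open>The radius \<open>\<rho>\<close> is chosen so that \<open>U \<le> t\<close> means that the distance is at most \<open>\<rho>\<close>; the factor
  \<open>card J\<close> in \<open>U\<close> cancels the number of points in both tail bounds, which are therefore uniform in
  the sample size.\<close>

lemma knn_volume_tails:
  fixes J :: "nat set" and v :: real
  assumes J: "finite J" "i \<notin> J" and k: "1 \<le> k" "k \<le> card J" and v: "0 < v"
  defines "U \<equiv> (\<lambda>x. card J * (v * knn_dist k (x i) (x ` J) ^ DIM('a)))"
  shows "AE x in PiM (insert i J) (\<lambda>_. \<mu>). 0 < U x"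
    and "0 < t \<Longrightarrow> (\<integral>\<^sup>+x. indicator {x. U x \<le> t} x \<partial>PiM (insert i J) (\<lambda>_. \<mu>))
      \<le> ennreal ((A / v * t) ^ k)"
    and "0 < t \<Longrightarrow> (\<integral>\<^sup>+x. indicator {x. t < U x} x \<partial>PiM (insert i J) (\<lambda>_. \<mu>))
      \<le> ennreal (2 ^ k * exp (- (c / (2 * v) * t)))"
proof -
  define P where "P = PiM (insert i J) (\<lambda>_. \<mu>)"
  define N where "N \<rho> x = card {j\<in>J. dist (x i) (x j) \<le> \<rho>}" for \<rho> and x :: "nat \<Rightarrow> 'a"
  define n where "n = real (card J)"
  have n: "0 < n" using k by (simp add: n_def)
  have inj: "AE x in P. inj_on x (insert i J)"
    unfolding P_def using J by (intro AE_sample_inj_on) auto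
  have knn: "(knn_dist k (x i) (x ` J) \<le> \<rho> \<longleftrightarrow> k \<le> N \<rho> x) \<and> 0 < knn_dist k (x i) (x ` J)"
    if "inj_on x (insert i J)" for x \<rho>
  proof -
    have xJ: "inj_on x J" "x i \<notin> x ` J" using that J(2) by auto
    then have cJ: "k \<le> card (x ` J)" using k(2) by (simp add: card_image)
    show ?thesis
      using J(1) k cJ xJ by (simp add: knn_dist_le_iff knn_dist_pos inj_on_card_near N_def)
  qed
  have "AE x in P. 0 < U x"
    using inj by eventually_elim (use n v knn in \<open>simp add: U_def n_def\<close>)
  then show "AE x in PiM (insert i J) (\<lambda>_. \<mu>). 0 < U x" unfolding P_def .
  assume t: "0 < t"
  define \<rho> where "\<rho> = root DIM('a) (t / (n * v))"
  have \<rho>: "0 \<le> \<rho>" "\<rho> ^ DIM('a) = t / (n * v)"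
    using t n v by (auto simp: \<rho>_def real_root_ge_zero)
  have U_le: "U x \<le> t \<longleftrightarrow> k \<le> N \<rho> x" if "inj_on x (insert i J)" for x
  proof -
    have pos: "0 \<le> knn_dist k (x i) (x ` J)" using knn[OF that] by (meson less_imp_le)
    have "U x \<le> t \<longleftrightarrow> knn_dist k (x i) (x ` J) ^ DIM('a) \<le> \<rho> ^ DIM('a)"
      using n v unfolding U_def \<rho>(2) n_def[symmetric] by (simp add: field_simps)
    also have "\<dots> \<longleftrightarrow> knn_dist k (x i) (x ` J) \<le> \<rho>"
      using pos \<rho>(1) by (simp add: power_mono_iff)
    finally show ?thesis using knn[OF that] by simp
  qed
  have [measurable]: "N \<rho> \<in> P \<rightarrow>\<^sub>M count_space UNIV"
    unfolding N_def P_def using J(1) by (intro measurable_near_count) auto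
  have upd: "N \<rho> (y(i := z)) = card {j\<in>J. dist z (y j) \<le> \<rho>}" for y z
    unfolding N_def using J(2) by (intro arg_cong[where f = card]) auto
  have "(\<integral>\<^sup>+x. indicator {x. U x \<le> t} x \<partial>P) \<le> (\<integral>\<^sup>+x. indicator {x. k \<le> N \<rho> x} x \<partial>P)"
  proof (rule nn_integral_mono_AE)
    show "AE x in P. indicator {x. U x \<le> t} x \<le> (indicator {x. k \<le> N \<rho> x} x :: ennreal)"
      using inj by eventually_elim (simp add: indicator_def U_le del: inj_on_insert)
  qed
  also have "\<dots> \<le> ennreal ((card J * (A * \<rho> ^ DIM('a))) ^ k)"
    unfolding P_def
  proof (rule nn_integral_sample_insert[OF J])
    show "indicator {x. k \<le> N \<rho> x} \<in> borel_measurable (PiM (insert i J) (\<lambda>_. \<mu>))"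
      unfolding P_def[symmetric] by measurable
    show "(\<integral>\<^sup>+y. indicator {x. k \<le> N \<rho> x} (y(i := z)) \<partial>PiM J (\<lambda>_. \<mu>))
        \<le> ennreal ((card J * (A * \<rho> ^ DIM('a))) ^ k)" for z
      using prob_many_near_le[OF J(1) \<rho>(1), of k z] by (simp add: indicator_def upd)
  qed
  also have "card J * (A * \<rho> ^ DIM('a)) = A / v * t"
    using n unfolding \<rho>(2) n_def[symmetric] by simp
  finally show "(\<integral>\<^sup>+x. indicator {x. U x \<le> t} x \<partial>PiM (insert i J) (\<lambda>_. \<mu>))
      \<le> ennreal ((A / v * t) ^ k)"
    by (simp add: P_def)
  show "(\<integral>\<^sup>+x. indicator {x. t < U x} x \<partial>PiM (insert i J) (\<lambda>_. \<mu>))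
      \<le> ennreal (2 ^ k * exp (- (c / (2 * v) * t)))"
  proof (cases "\<rho> \<le> D")
    case True
    have "(\<integral>\<^sup>+x. indicator {x. t < U x} x \<partial>P) \<le> (\<integral>\<^sup>+x. indicator {x. N \<rho> x < k} x \<partial>P)"
    proof (rule nn_integral_mono_AE)
      show "AE x in P. indicator {x. t < U x} x \<le> (indicator {x. N \<rho> x < k} x :: ennreal)"
        using inj by eventually_elim
          (simp add: indicator_def U_le not_le[symmetric] del: inj_on_insert)
    qed
    also have "\<dots> \<le> ennreal (2 ^ k * exp (- (card J * (c * \<rho> ^ DIM('a)) / 2)))"
      unfolding P_def
    proof (rule nn_integral_sample_insert[OF J])
      show "indicator {x. N \<rho> x < k} \<in> borel_measurable (PiM (insert i J) (\<lambda>_. \<mu>))"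
        unfolding P_def[symmetric] by measurable
      show "(\<integral>\<^sup>+y. indicator {x. N \<rho> x < k} (y(i := z)) \<partial>PiM J (\<lambda>_. \<mu>))
          \<le> ennreal (2 ^ k * exp (- (card J * (c * \<rho> ^ DIM('a)) / 2)))" if "z \<in> S" for z
        using prob_few_near_le[OF J(1) that \<rho>(1) True, of k] by (simp add: indicator_def upd)
    qed
    also have "card J * (c * \<rho> ^ DIM('a)) / 2 = c / (2 * v) * t"
      using n unfolding \<rho>(2) n_def[symmetric] by simp
    finally show ?thesis by (simp add: P_def)
  next
    case False
    \<comment> \<open>All sample points lie within distance \<open>D\<close> of each other, so the tail is empty.\<close>
    have "AE x in P. \<forall>j\<in>insert i J. x j \<in> S"
      unfolding P_def using J by (intro AE_sample_in_S) auto
    with inj have "AE x in P. \<not> t < U x"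
    proof eventually_elim
      case (elim x)
      then have "{j\<in>J. dist (x i) (x j) \<le> \<rho>} = J"
        using False dist_S by force
      then show ?case using U_le[OF elim(1)] k(2) by (simp add: N_def)
    qed
    then have "(\<integral>\<^sup>+x. indicator {x. t < U x} x \<partial>P) = (\<integral>\<^sup>+x. 0 \<partial>P)"
      by (intro nn_integral_cong_AE) (auto elim!: eventually_mono split: split_indicator)
    then show ?thesis by (simp add: P_def)
  qed
qed

end

section \<open>Second moments\<close>

lemma ennreal_le_suminf: "f l \<le> suminf f" for f :: "nat \<Rightarrow> ennreal"
  using sum_le_suminf[of f "{l}"] by simp

text \<open>The unit interval is cut at powers of \<open>1/2\<close> and the half line at integers, so that the second
  moment of the envelope becomes a series of tail probabilities. For \<open>a < 0\<close> and
  \<open>b > 0\<close> the weights are the larger endpoint values of the pieces; for the other signs, where the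
  envelope is bounded by \<open>1\<close>, the maxima with \<open>0\<close> turn the weights into \<open>1\<close>.\<close>

lemma poly_envelope_dyadic_le:
  assumes u: "0 < u"
  shows "ennreal ((poly_envelope a b u)\<^sup>2)
    \<le> (\<Sum>l. ennreal (2 powr (2 * max 0 (- a) * (real l + 1))) * indicator {..(1 / 2) ^ l} u)
      + (\<Sum>l. ennreal ((real l + 2) powr (2 * max 0 b)) * indicator {real l + 1<..} u)"
    (is "_ \<le> (\<Sum>l. ?f l) + (\<Sum>l. ?g l)")
proof (cases "u \<le> 1")
  case True
  define n where "n = (LEAST n. (1 / 2 :: real) ^ n < u)"
  obtain n' where "(1 / 2 :: real) ^ n' < u"
    using real_arch_pow_inv[OF u, of "1 / 2"] by auto
  then have n: "(1 / 2) ^ n < u" unfolding n_def by (rule LeastI)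
  then obtain l where l: "n = Suc l" using True by (cases n) auto
  have upper: "u \<le> (1 / 2) ^ l"
    using not_less_Least[of l "\<lambda>n. (1 / 2 :: real) ^ n < u"] l by (simp add: n_def not_less)
  have "2 powr - (real l + 1) = inverse (2 powr real n)"
    by (simp add: l powr_minus[symmetric] algebra_simps)
  also have "\<dots> = (1 / 2) ^ n"
    by (simp add: powr_realpow power_one_over inverse_eq_divide)
  finally have lower: "2 powr - (real l + 1) < u"
    using n by simp
  have "(u powr a)\<^sup>2 = u powr (2 * a)"
    by (simp add: power2_eq_square powr_add[symmetric])
  also have "\<dots> \<le> 2 powr (2 * max 0 (- a) * (real l + 1))"
  proof (cases "0 \<le> a")
    case True
    then have "u powr (2 * a) \<le> 1 powr (2 * a)"
      using u \<open>u \<le> 1\<close> by (intro powr_mono2) auto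
    then show ?thesis using True by simp
  next
    case False
    then have "u powr (2 * a) \<le> (2 powr - (real l + 1)) powr (2 * a)"
      using lower by (intro powr_mono2') auto
    then show ?thesis using False by (simp add: powr_powr max_def algebra_simps)
  qed
  finally have "ennreal ((poly_envelope a b u)\<^sup>2) \<le> ?f l"
    using True upper by (simp add: poly_envelope_def ennreal_leI)
  also have "\<dots> \<le> (\<Sum>l. ?f l)"
    by (rule ennreal_le_suminf)
  finally show ?thesis by (meson add_increasing2 zero_le)
next
  case False
  define m where "m = (LEAST m. u \<le> real m)"
  obtain m' where "u \<le> real m'" using real_arch_simple by blast
  then have m: "u \<le> real m" unfolding m_def by (rule LeastI)
  then have "2 \<le> m" using False by (cases m; cases "m - 1") auto
  then obtain l where l: "m = l + 2" using le_Suc_ex by (metis add.commute)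
  have lower: "real l + 1 < u"
    using not_less_Least[of "l + 1" "\<lambda>m. u \<le> real m"] l by (simp add: m_def not_le)
  have "(u powr b)\<^sup>2 = u powr (2 * b)"
    by (simp add: power2_eq_square powr_add[symmetric])
  also have "\<dots> \<le> u powr (2 * max 0 b)"
    using False by (intro powr_mono) auto
  also have "\<dots> \<le> (real l + 2) powr (2 * max 0 b)"
    using u m l by (intro powr_mono2) auto
  finally have "ennreal ((poly_envelope a b u)\<^sup>2) \<le> ?g l"
    using False lower by (simp add: poly_envelope_def ennreal_leI)
  also have "\<dots> \<le> (\<Sum>l. ?g l)"
    by (rule ennreal_le_suminf)
  finally show ?thesis by (meson add_increasing zero_le)
qed

text \<open>The series at \<open>0\<close> is geometric with ratio \<open>2\<^sup>\<alpha>\<^sup>-\<^sup>k\<close> for \<open>\<alpha> = 2 max 0 (- a)\<close>, which is where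
  \<open>k > - 2 a\<close> is needed; the series at infinity converges because of the exponential. The
  bound \<open>K\<close> is the same for all \<open>P\<close> and \<open>U\<close> with these tails, hence for all sample sizes.\<close>

lemma second_moment_envelope:
  fixes a b A B \<beta> :: real
  assumes k: "real k > - 2 * a" "1 \<le> k" and pos: "0 < A" "0 < B" "0 < \<beta>"
  obtains K where "\<And>(P :: 'z measure) U. U \<in> borel_measurable P \<Longrightarrow> AE x in P. 0 < U x \<Longrightarrow>
      (\<And>t. 0 < t \<Longrightarrow> (\<integral>\<^sup>+x. indicator {x. U x \<le> t} x \<partial>P) \<le> ennreal ((A * t) ^ k)) \<Longrightarrow>
      (\<And>t. 0 < t \<Longrightarrow> (\<integral>\<^sup>+x. indicator {x. t < U x} x \<partial>P) \<le> ennreal (B * exp (- (\<beta> * t)))) \<Longrightarrow>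
      (\<integral>\<^sup>+x. ennreal ((poly_envelope a b (U x))\<^sup>2) \<partial>P) \<le> ennreal K"
proof -
  define w where "w l = 2 powr (2 * max 0 (- a) * (real l + 1))" for l :: nat
  define z where "z l = (real l + 2) powr (2 * max 0 b)" for l :: nat
  define f where "f l = w l * (A * (1 / 2) ^ l) ^ k" for l
  define g where "g l = z l * (B * exp (- (\<beta> * (real l + 1))))" for l
  have f_nonneg: "0 \<le> f l" and g_nonneg: "0 \<le> g l" for l
    using pos by (simp_all add: f_def g_def w_def z_def)
  have "summable f"
  proof -
    define \<alpha> where "\<alpha> = 2 * max 0 (- a)"
    define r where "r = 2 powr (\<alpha> - real k)"
    have "\<alpha> < real k" using k by (auto simp: \<alpha>_def max_def)
    then have r: "0 < r" "r < 1" by (auto simp: r_def powr_less_one)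
    have "f l = 2 powr \<alpha> * A ^ k * r ^ l" for l
    proof -
      have "w l = 2 powr \<alpha> * (2 powr \<alpha>) ^ l"
        by (simp add: w_def \<alpha>_def[symmetric] powr_add distrib_left powr_powr[symmetric] powr_realpow)
      moreover have "r ^ l = (2 powr \<alpha>) ^ l * ((1 / 2) ^ l) ^ k"
        by (simp add: r_def powr_diff powr_realpow power_divide power_mult[symmetric] mult.commute)
      ultimately show ?thesis by (simp add: f_def power_mult_distrib)
    qed
    then have "f = (\<lambda>l. 2 powr \<alpha> * A ^ k * r ^ l)" by (rule ext)
    moreover have "summable (\<lambda>l. 2 powr \<alpha> * A ^ k * r ^ l)"
      using r by (intro summable_mult summable_geometric) simp
    ultimately show ?thesis by (simp only:)
  qed
  have "summable g"
  proof -
    have "g \<in> O(\<lambda>l. 1 / real l ^ 2)"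
      unfolding g_def z_def using pos by real_asymp
    then show ?thesis
      by (rule summable_comparison_test_bigo[rotated]) (simp add: inverse_power_summable[of 2, simplified inverse_eq_divide])
  qed
  show ?thesis
  proof (rule that)
    fix P :: "'z measure" and U
    assume U [measurable]: "U \<in> borel_measurable P" and U_pos: "AE x in P. 0 < U x"
      and near: "\<And>t. 0 < t \<Longrightarrow> (\<integral>\<^sup>+x. indicator {x. U x \<le> t} x \<partial>P) \<le> ennreal ((A * t) ^ k)"
      and far: "\<And>t. 0 < t \<Longrightarrow> (\<integral>\<^sup>+x. indicator {x. t < U x} x \<partial>P) \<le> ennreal (B * exp (- (\<beta> * t)))"
    have "(\<integral>\<^sup>+x. ennreal ((poly_envelope a b (U x))\<^sup>2) \<partial>P)
        \<le> (\<integral>\<^sup>+x. (\<Sum>l. ennreal (w l) * indicator {..(1 / 2) ^ l} (U x))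
          + (\<Sum>l. ennreal (z l) * indicator {real l + 1<..} (U x)) \<partial>P)"
      using U_pos unfolding w_def z_def
      by (intro nn_integral_mono_AE) (auto elim!: eventually_mono intro!: poly_envelope_dyadic_le)
    also have "\<dots> = (\<integral>\<^sup>+x. (\<Sum>l. ennreal (w l) * indicator {..(1 / 2) ^ l} (U x)) \<partial>P)
        + (\<integral>\<^sup>+x. (\<Sum>l. ennreal (z l) * indicator {real l + 1<..} (U x)) \<partial>P)"
      by (rule nn_integral_add) measurable
    also have "(\<integral>\<^sup>+x. (\<Sum>l. ennreal (w l) * indicator {..(1 / 2) ^ l} (U x)) \<partial>P)
        = (\<Sum>l. ennreal (w l) * (\<integral>\<^sup>+x. indicator {x. U x \<le> (1 / 2) ^ l} x \<partial>P))"
      by (subst nn_integral_suminf) (auto simp: nn_integral_cmult indicator_def[abs_def])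
    also have "(\<integral>\<^sup>+x. (\<Sum>l. ennreal (z l) * indicator {real l + 1<..} (U x)) \<partial>P)
        = (\<Sum>l. ennreal (z l) * (\<integral>\<^sup>+x. indicator {x. real l + 1 < U x} x \<partial>P))"
      by (subst nn_integral_suminf) (auto simp: nn_integral_cmult indicator_def[abs_def])
    also have "(\<Sum>l. ennreal (w l) * (\<integral>\<^sup>+x. indicator {x. U x \<le> (1 / 2) ^ l} x \<partial>P))
        + (\<Sum>l. ennreal (z l) * (\<integral>\<^sup>+x. indicator {x. real l + 1 < U x} x \<partial>P))
        \<le> (\<Sum>l. ennreal (f l)) + (\<Sum>l. ennreal (g l))"
    proof (intro add_mono suminf_le)
      fix l
      show "ennreal (w l) * (\<integral>\<^sup>+x. indicator {x. U x \<le> (1 / 2) ^ l} x \<partial>P) \<le> ennreal (f l)"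
        using near[of "(1 / 2) ^ l"] pos
        by (simp add: f_def w_def ennreal_mult mult_left_mono)
      show "ennreal (z l) * (\<integral>\<^sup>+x. indicator {x. real l + 1 < U x} x \<partial>P) \<le> ennreal (g l)"
        using far[of "real l + 1"] pos
        by (simp add: g_def z_def ennreal_mult mult_left_mono)
    qed auto
    also have "\<dots> = ennreal (suminf f + suminf g)"
      using \<open>summable f\<close> \<open>summable g\<close> f_nonneg g_nonneg
      by (simp add: suminf_ennreal2 suminf_nonneg)
    finally show "(\<integral>\<^sup>+x. ennreal ((poly_envelope a b (U x))\<^sup>2) \<partial>P) \<le> ennreal (suminf f + suminf g)" .
  qed
qed

lemma knn_dist_leave_one_out_cases:
  fixes x :: "'i \<Rightarrow> 'a::metric_space"
  assumes I: "finite I" and inj: "inj_on x I" and k: "1 \<le> k" "k + 2 \<le> card I"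
    and ij: "i \<in> I" "j \<in> I" "i \<noteq> j"
  shows "knn_dist k (x j) (x ` (I - {i} - {j})) \<in>
    {knn_dist k (x j) (x ` (I - {j})), knn_dist (k + 1) (x j) (x ` (I - {j}))}"
proof -
  have img: "x ` (I - {i} - {j}) = x ` (I - {j}) - {x i}"
    using inj ij by (auto simp: inj_on_def)
  have "inj_on x (I - {j})" using inj by (rule inj_on_subset) auto
  then have "card (x ` (I - {j})) = card I - 1"
    using ij I by (simp add: card_image)
  then have "k + 1 \<le> card (x ` (I - {j}))" using k by simp
  then show ?thesis
    using knn_dist_remove(3)[of "x ` (I - {j})" k "x i" "x j"] I k ij unfolding img by auto
qed

lemma knn_sum_cong:
  assumes "\<And>j. j \<in> I \<Longrightarrow> x j = y j"
  shows "knn_sum k h I x = knn_sum k h I y"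
proof -
  have "x ` (I - {j}) = y ` (I - {j})" for j using assms by (intro image_cong) auto
  then show ?thesis unfolding knn_sum_def using assms by (intro sum.cong) auto
qed

text \<open>Truncating at \<open>0\<close> makes the formula for the volume of a ball valid for every radius, in
  particular for the meaningless distances in samples with fewer than \<open>k\<close> distinct neighbours.\<close>

definition volume_stat :: "nat \<Rightarrow> (real \<Rightarrow> real) \<Rightarrow> real \<Rightarrow> nat \<Rightarrow> real \<Rightarrow> real" where
  "volume_stat d \<phi> v n r = \<phi> (real n * (v * max 0 r ^ d))"

lemma borel_measurable_volume_stat:
  assumes "\<phi>' \<in> borel_measurable borel" "\<And>u. 0 \<le> u \<Longrightarrow> \<phi> u = \<phi>' u" "0 < v"
  shows "volume_stat d \<phi> v n \<in> borel_measurable borel"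
proof -
  note [measurable] = assms(1)
  have "volume_stat d \<phi> v n = (\<lambda>r. \<phi>' (real n * (v * max 0 r ^ d)))"
    using assms(2,3) by (auto simp: volume_stat_def)
  then show ?thesis by simp
qed

context knn_sampling
begin

lemma borel_measurable_knn_term:
  assumes [measurable]: "h \<in> borel_measurable borel" and "finite J" "J \<subseteq> I" "i \<in> I" "1 \<le> k"
  shows "(\<lambda>x. h (knn_dist k (x i) (x ` J))) \<in> borel_measurable (PiM I (\<lambda>_. \<mu>))"
proof -
  have comp: "(\<lambda>x. x j) \<in> borel_measurable (PiM I (\<lambda>_. \<mu>))" if "j \<in> I" for j
    using measurable_component_singleton[OF that, of "\<lambda>_. \<mu>"]
    by (simp only: measurable_cong_sets[OF refl sets_mu])
  have "(\<lambda>x. knn_dist k (x i) ((\<lambda>j. x j) ` J)) \<in> borel_measurable (PiM I (\<lambda>_. \<mu>))"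
    using assms comp by (intro borel_measurable_knn_dist) auto
  then show ?thesis by measurable
qed

lemma second_moment_knn_term:
  fixes a b v C\<phi> :: real
  assumes k: "1 \<le> k" "real k > - 2 * a" and v: "0 < v"
    and \<phi>: "\<And>u. 0 < u \<Longrightarrow> \<bar>\<phi> u\<bar> \<le> C\<phi> * poly_envelope a b u"
  obtains B where "\<And>J i. finite (J :: nat set) \<Longrightarrow> i \<notin> J \<Longrightarrow> k \<le> card J \<Longrightarrow>
    (\<integral>\<^sup>+x. ennreal ((volume_stat DIM('a) \<phi> v (card J) (knn_dist k (x i) (x ` J)))\<^sup>2)
      \<partial>PiM (insert i J) (\<lambda>_. \<mu>)) \<le> ennreal B"
proof -
  have pos: "0 < A / v" "0 < (2::real) ^ k" "0 < c / (2 * v)"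
    using A_pos c_pos v by auto
  obtain K where K: "\<And>(P :: (nat \<Rightarrow> 'a) measure) U. U \<in> borel_measurable P \<Longrightarrow>
      AE x in P. 0 < U x \<Longrightarrow>
      (\<And>t. 0 < t \<Longrightarrow> (\<integral>\<^sup>+x. indicator {x. U x \<le> t} x \<partial>P) \<le> ennreal ((A / v * t) ^ k)) \<Longrightarrow>
      (\<And>t. 0 < t \<Longrightarrow> (\<integral>\<^sup>+x. indicator {x. t < U x} x \<partial>P)
        \<le> ennreal (2 ^ k * exp (- (c / (2 * v) * t)))) \<Longrightarrow>
      (\<integral>\<^sup>+x. ennreal ((poly_envelope a b (U x))\<^sup>2) \<partial>P) \<le> ennreal K"
    using second_moment_envelope[OF k(2,1) pos, where 'z = "nat \<Rightarrow> 'a"] by blast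
  show ?thesis
  proof (rule that)
    fix J :: "nat set" and i
    assume J: "finite J" "i \<notin> J" "k \<le> card J"
    define P where "P = PiM (insert i J) (\<lambda>_. \<mu>)"
    define R where "R x = knn_dist k (x i) (x ` J)" for x :: "nat \<Rightarrow> 'a"
    define U where "U x = card J * (v * R x ^ DIM('a))" for x
    have [measurable]: "R \<in> borel_measurable P"
      using borel_measurable_knn_term[of "\<lambda>r. r" J "insert i J" i k] J k
      unfolding P_def R_def by auto
    have U_meas [measurable]: "U \<in> borel_measurable P"
      unfolding U_def by measurable
    have U_pos: "AE x in P. 0 < U x"
      unfolding P_def U_def R_def by (rule knn_volume_tails(1)) (use J k v in auto)
    have env: "(\<integral>\<^sup>+x. ennreal ((poly_envelope a b (U x))\<^sup>2) \<partial>P) \<le> ennreal K"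
      unfolding P_def
    proof (rule K)
      show "U \<in> borel_measurable (PiM (insert i J) (\<lambda>_. \<mu>))"
        using U_meas by (simp only: P_def)
      show "AE x in PiM (insert i J) (\<lambda>_. \<mu>). 0 < U x"
        using U_pos by (simp only: P_def)
      show "(\<integral>\<^sup>+x. indicator {x. U x \<le> t} x \<partial>PiM (insert i J) (\<lambda>_. \<mu>)) \<le> ennreal ((A / v * t) ^ k)"
        if "0 < t" for t
        unfolding U_def R_def by (rule knn_volume_tails(2)) (use J k v that in auto)
      show "(\<integral>\<^sup>+x. indicator {x. t < U x} x \<partial>PiM (insert i J) (\<lambda>_. \<mu>))
          \<le> ennreal (2 ^ k * exp (- (c / (2 * v) * t)))" if "0 < t" for t
        unfolding U_def R_def by (rule knn_volume_tails(3)) (use J k v that in auto)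
    qed
    have inj: "AE x in P. inj_on x (insert i J)"
      unfolding P_def using J by (intro AE_sample_inj_on) auto
    have env_meas: "(\<lambda>u. (poly_envelope a b u)\<^sup>2) \<in> borel_measurable borel"
      unfolding poly_envelope_def by measurable
    have "(\<integral>\<^sup>+x. ennreal ((volume_stat DIM('a) \<phi> v (card J) (R x))\<^sup>2) \<partial>P)
        \<le> (\<integral>\<^sup>+x. ennreal (C\<phi>\<^sup>2) * ennreal ((poly_envelope a b (U x))\<^sup>2) \<partial>P)"
    proof (rule nn_integral_mono_AE)
      show "AE x in P. ennreal ((volume_stat DIM('a) \<phi> v (card J) (R x))\<^sup>2)
          \<le> ennreal (C\<phi>\<^sup>2) * ennreal ((poly_envelope a b (U x))\<^sup>2)"
        using U_pos inj
      proof eventually_elim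
        case (elim x)
        have "inj_on x J" using elim(2) by (rule inj_on_subset) auto
        then have "0 \<le> R x"
          unfolding R_def using J k by (intro knn_dist_nonneg) (auto simp: card_image)
        then have eq: "volume_stat DIM('a) \<phi> v (card J) (R x) = \<phi> (U x)"
          by (simp add: volume_stat_def U_def)
        have "(\<phi> (U x))\<^sup>2 \<le> (C\<phi> * poly_envelope a b (U x))\<^sup>2"
          using power_mono[OF \<phi>[OF elim(1)], of 2] by simp
        then show ?case
          unfolding eq by (simp add: power_mult_distrib ennreal_mult[symmetric] ennreal_leI)
      qed
    qed
    also have "\<dots> = ennreal (C\<phi>\<^sup>2) * (\<integral>\<^sup>+x. ennreal ((poly_envelope a b (U x))\<^sup>2) \<partial>P)"
      using measurable_compose[OF U_meas env_meas]
      by (intro nn_integral_cmult measurable_compose[OF _ measurable_ennreal])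
    also have "\<dots> \<le> ennreal (C\<phi>\<^sup>2) * ennreal K"
      using env by (rule mult_left_mono) simp
    also have "\<dots> = ennreal (C\<phi>\<^sup>2 * K)" by (simp add: ennreal_mult')
    finally show "(\<integral>\<^sup>+x. ennreal ((volume_stat DIM('a) \<phi> v (card J) (knn_dist k (x i) (x ` J)))\<^sup>2)
      \<partial>PiM (insert i J) (\<lambda>_. \<mu>)) \<le> ennreal (C\<phi>\<^sup>2 * K)"
      by (simp add: P_def R_def)
  qed
qed

end

section \<open>The variance bound for independent samples\<close>

lemma integrable_of_nn_integral_square:
  fixes f :: "'a \<Rightarrow> real"
  assumes "finite_measure M" and f: "f \<in> borel_measurable M"
    and le: "(\<integral>\<^sup>+x. ennreal ((f x)\<^sup>2) \<partial>M) \<le> ennreal B"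
  shows "integrable M (\<lambda>x. (f x)\<^sup>2)" and "integrable M f"
proof -
  interpret finite_measure M by fact
  note [measurable] = f
  have "(\<integral>\<^sup>+x. ennreal ((f x)\<^sup>2) \<partial>M) < \<infinity>"
    using le by (rule le_less_trans) simp
  then show "integrable M (\<lambda>x. (f x)\<^sup>2)"
    by (intro integrableI_bounded) simp_all
  then show "integrable M f"
    by (rule square_integrable_imp_integrable[OF f])
qed

context knn_sampling
begin

text \<open>Ranks \<open>k\<close> and \<open>k + 1\<close> both satisfy the moment condition, so one constant \<open>B\<close> bounds the second
  moments of the original and of the shifted terms. Summing over the points gives \<open>2 B card I\<close>, and
  the factor \<open>1 / (card I)\<^sup>2\<close> from the averaging leaves the rate \<open>1 / card I\<close>.\<close>

lemma variance_knn_sum_le: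
  fixes a b v C\<phi> :: real and \<phi> \<phi>' :: "real \<Rightarrow> real"
  assumes k: "1 \<le> k" "real k > - 2 * a" and v: "0 < v"
    and \<phi>: "\<And>u. 0 < u \<Longrightarrow> \<bar>\<phi> u\<bar> \<le> C\<phi> * poly_envelope a b u"
    and \<phi>': "\<phi>' \<in> borel_measurable borel" "\<And>u. 0 \<le> u \<Longrightarrow> \<phi> u = \<phi>' u"
  obtains C where "\<And>(I :: nat set) (T :: (nat \<Rightarrow> 'a) \<Rightarrow> real). finite I \<Longrightarrow> k + 2 \<le> card I \<Longrightarrow>
    T = (\<lambda>x. knn_sum k (volume_stat DIM('a) \<phi> v (card I - 1)) I x / card I) \<Longrightarrow>
    integrable (PiM I (\<lambda>_. \<mu>)) T \<and> integrable (PiM I (\<lambda>_. \<mu>)) (\<lambda>x. (T x)\<^sup>2) \<and>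
    (\<integral>\<^sup>+x. ennreal ((T x - (\<integral>y. T y \<partial>PiM I (\<lambda>_. \<mu>)))\<^sup>2) \<partial>PiM I (\<lambda>_. \<mu>)) \<le> ennreal (C / card I)"
proof -
  have k1: "1 \<le> k + 1" "real (k + 1) > - 2 * a" using k by auto
  obtain B0 where B0: "\<And>J i. finite (J :: nat set) \<Longrightarrow> i \<notin> J \<Longrightarrow> k \<le> card J \<Longrightarrow>
      (\<integral>\<^sup>+x. ennreal ((volume_stat DIM('a) \<phi> v (card J) (knn_dist k (x i) (x ` J)))\<^sup>2)
      \<partial>PiM (insert i J) (\<lambda>_. \<mu>)) \<le> ennreal B0"
    using second_moment_knn_term[OF k v \<phi>] by blast
  obtain B1 where B1: "\<And>J i. finite (J :: nat set) \<Longrightarrow> i \<notin> J \<Longrightarrow> k + 1 \<le> card J \<Longrightarrow>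
      (\<integral>\<^sup>+x. ennreal ((volume_stat DIM('a) \<phi> v (card J) (knn_dist (k + 1) (x i) (x ` J)))\<^sup>2)
      \<partial>PiM (insert i J) (\<lambda>_. \<mu>)) \<le> ennreal B1"
    using second_moment_knn_term[OF k1 v \<phi>] by blast
  define B where "B = max 0 (max B0 B1)"
  obtain K0 :: nat where K0: "\<And>(P :: 'a set) z k. finite P \<Longrightarrow> z \<notin> P \<Longrightarrow>
      card {y\<in>P. card {w\<in>P - {y}. dist y w < dist y z} < k} \<le> K0 * k"
    using cone_cover by blast
  define C1 where "C1 = 2 + 4 * real (K0 * k) * real k"
  have C1: "0 \<le> C1" by (simp add: C1_def)
  show ?thesis
  proof (rule that)
    fix I :: "nat set" and T :: "(nat \<Rightarrow> 'a) \<Rightarrow> real"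
    assume I: "finite I" "k + 2 \<le> card I"
      and T_def: "T = (\<lambda>x. knn_sum k (volume_stat DIM('a) \<phi> v (card I - 1)) I x / card I)"
    define P where "P = PiM I (\<lambda>_. \<mu>)"
    define m where "m = real (card I)"
    have m: "0 < m" using I by (simp add: m_def)
    interpret P: prob_space P unfolding P_def by (rule prob_space_sample)
    define h where "h = volume_stat DIM('a) \<phi> v (card I - 1)"
    have h: "h \<in> borel_measurable borel"
      unfolding h_def by (rule borel_measurable_volume_stat[OF \<phi>' v])
    define Y where "Y l j x = h (knn_dist l (x j) (x ` (I - {j})))" for l j and x :: "nat \<Rightarrow> 'a"
    have Y_meas: "Y l j \<in> borel_measurable P" if "j \<in> I" "1 \<le> l" for l j
      unfolding Y_def P_def using h I that by (intro borel_measurable_knn_term) auto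
    have Y_sq: "(\<integral>\<^sup>+x. ennreal ((Y l j x)\<^sup>2) \<partial>P) \<le> ennreal B" if "j \<in> I" "l = k \<or> l = k + 1" for l j
    proof -
      have ins: "insert j (I - {j}) = I" "card (I - {j}) = card I - 1" using that I by auto
      have "(\<integral>\<^sup>+x. ennreal ((Y k j x)\<^sup>2) \<partial>P) \<le> ennreal B0"
        using B0[of "I - {j}" j] I unfolding ins h_def[symmetric] P_def Y_def by simp
      moreover have "(\<integral>\<^sup>+x. ennreal ((Y (k + 1) j x)\<^sup>2) \<partial>P) \<le> ennreal B1"
        using B1[of "I - {j}" j] I unfolding ins h_def[symmetric] P_def Y_def by simp
      moreover have "ennreal B0 \<le> ennreal B" "ennreal B1 \<le> ennreal B"
        by (auto simp: B_def intro!: ennreal_leI)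
      ultimately show ?thesis using that(2) order_trans by blast
    qed
    have Y_int: "integrable P (\<lambda>x. (Y l j x)\<^sup>2)" "integrable P (Y l j)"
      if "j \<in> I" "l = k \<or> l = k + 1" for l j
      using integrable_of_nn_integral_square[OF P.finite_measure_axioms Y_meas Y_sq] that k(1) by auto
    have T_eq: "T = (\<lambda>x. knn_sum k h I x / m)"
      by (simp add: T_def h_def m_def)
    have T: "T = (\<lambda>x. (\<Sum>j\<in>I. Y k j x) / m)"
      by (simp add: T_eq knn_sum_def Y_def)
    have T_int: "integrable P T"
      unfolding T using Y_int by (intro integrable_divide Bochner_Integration.integrable_sum) auto
    have T2_int: "integrable P (\<lambda>x. (T x)\<^sup>2)"
    proof (rule Bochner_Integration.integrable_bound)
      show "integrable P (\<lambda>x. (\<Sum>j\<in>I. (Y k j x)\<^sup>2) * m / m\<^sup>2)"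
        using Y_int by (intro integrable_divide integrable_mult_left Bochner_Integration.integrable_sum) auto
      show "(\<lambda>x. (T x)\<^sup>2) \<in> borel_measurable P"
        using borel_measurable_integrable[OF T_int] by measurable
      have bound: "(T x)\<^sup>2 \<le> (\<Sum>j\<in>I. (Y k j x)\<^sup>2) * m / m\<^sup>2" for x
        unfolding T power_divide m_def
        by (intro divide_right_mono sum_squared_le_sum_of_squares) auto
      show "AE x in P. norm ((T x)\<^sup>2) \<le> norm ((\<Sum>j\<in>I. (Y k j x)\<^sup>2) * m / m\<^sup>2)"
        unfolding real_norm_def abs_power2 by (intro AE_I2 order_trans[OF bound abs_ge_self])
    qed
    define T' where "T' i x = knn_sum k h (I - {i}) x / m" for i and x :: "nat \<Rightarrow> 'a"
    have inj: "AE x in P. inj_on x I"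
      unfolding P_def by (rule AE_sample_inj_on[OF I(1)])
    have T'_int: "integrable P (T' i)" if i: "i \<in> I" for i
    proof (rule Bochner_Integration.integrable_bound)
      show "integrable P (\<lambda>x. \<Sum>j\<in>I - {i}. (\<bar>Y k j x\<bar> + \<bar>Y (k + 1) j x\<bar>) / m)"
        using Y_int by (intro Bochner_Integration.integrable_sum integrable_divide
            Bochner_Integration.integrable_add integrable_abs) auto
      have "(\<lambda>x. h (knn_dist k (x j) (x ` (I - {i} - {j})))) \<in> borel_measurable P" if "j \<in> I - {i}" for j
        unfolding P_def using h I k(1) that by (intro borel_measurable_knn_term) auto
      then show "T' i \<in> borel_measurable P"
        unfolding T'_def knn_sum_def by (intro borel_measurable_divide borel_measurable_sum) auto
      show "AE x in P. norm (T' i x) \<le> norm (\<Sum>j\<in>I - {i}. (\<bar>Y k j x\<bar> + \<bar>Y (k + 1) j x\<bar>) / m)"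
        using inj
      proof eventually_elim
        case (elim x)
        have "\<bar>h (knn_dist k (x j) (x ` (I - {i} - {j})))\<bar> \<le> \<bar>Y k j x\<bar> + \<bar>Y (k + 1) j x\<bar>"
          if "j \<in> I - {i}" for j
          using knn_dist_leave_one_out_cases[OF I(1) elim k(1) I(2) i, of j] that
          unfolding Y_def by auto
        then have "\<bar>knn_sum k h (I - {i}) x\<bar> \<le> (\<Sum>j\<in>I - {i}. \<bar>Y k j x\<bar> + \<bar>Y (k + 1) j x\<bar>)"
          unfolding knn_sum_def by (intro order_trans[OF sum_abs] sum_mono)
        then show ?case
          using m by (simp add: T'_def sum_divide_distrib[symmetric] divide_right_mono sum_nonneg)
      qed
    qed
    have T'_dep: "T' i (x(i := z)) = T' i x" for i x z
      unfolding T'_def by (subst knn_sum_cong[of "I - {i}" "x(i := z)" x]) auto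
    have "(\<integral>\<^sup>+x. ennreal ((T x - (\<integral>y. T y \<partial>P))\<^sup>2) \<partial>P)
        \<le> (\<Sum>i\<in>I. \<integral>\<^sup>+x. ennreal ((T x - T' i x)\<^sup>2) \<partial>P)"
      unfolding P_def
      by (rule Efron_Stein) (use I(1) T_int T'_int T'_dep prob_space_axioms in \<open>auto simp: P_def\<close>)
    also have "\<dots> = (\<integral>\<^sup>+x. (\<Sum>i\<in>I. ennreal ((T x - T' i x)\<^sup>2)) \<partial>P)"
    proof (rule nn_integral_sum[symmetric])
      fix i assume "i \<in> I"
      then have [measurable]: "T' i \<in> borel_measurable P"
        by (intro borel_measurable_integrable T'_int)
      note [measurable] = borel_measurable_integrable[OF T_int]
      show "(\<lambda>x. ennreal ((T x - T' i x)\<^sup>2)) \<in> borel_measurable P" by measurable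
    qed
    also have "\<dots> \<le> (\<integral>\<^sup>+x. ennreal (C1 / m\<^sup>2) *
        (\<Sum>j\<in>I. ennreal ((Y k j x)\<^sup>2) + ennreal ((Y (k + 1) j x)\<^sup>2)) \<partial>P)"
    proof (rule nn_integral_mono_AE)
      show "AE x in P. (\<Sum>i\<in>I. ennreal ((T x - T' i x)\<^sup>2)) \<le> ennreal (C1 / m\<^sup>2) *
          (\<Sum>j\<in>I. ennreal ((Y k j x)\<^sup>2) + ennreal ((Y (k + 1) j x)\<^sup>2))"
        using inj
      proof eventually_elim
        case (elim x)
        have "(\<Sum>i\<in>I. (T x - T' i x)\<^sup>2) = (\<Sum>i\<in>I. (knn_sum k h I x - knn_sum k h (I - {i}) x)\<^sup>2) / m\<^sup>2"
          by (simp add: T_eq T'_def sum_divide_distrib power_divide diff_divide_distrib[symmetric])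
        also have "\<dots> \<le> C1 * (\<Sum>j\<in>I. (Y k j x)\<^sup>2 + (Y (k + 1) j x)\<^sup>2) / m\<^sup>2"
          unfolding C1_def Y_def
          by (intro divide_right_mono knn_sum_leave_one_out_le[OF I(1) elim k(1) I(2) K0]) auto
        finally have le: "(\<Sum>i\<in>I. (T x - T' i x)\<^sup>2)
            \<le> C1 / m\<^sup>2 * (\<Sum>j\<in>I. (Y k j x)\<^sup>2 + (Y (k + 1) j x)\<^sup>2)"
          by simp
        have "(\<Sum>i\<in>I. ennreal ((T x - T' i x)\<^sup>2)) = ennreal (\<Sum>i\<in>I. (T x - T' i x)\<^sup>2)"
          by (rule sum_ennreal) simp
        also have "\<dots> \<le> ennreal (C1 / m\<^sup>2 * (\<Sum>j\<in>I. (Y k j x)\<^sup>2 + (Y (k + 1) j x)\<^sup>2))"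
          using le by (rule ennreal_leI)
        also have "\<dots> = ennreal (C1 / m\<^sup>2) * ennreal (\<Sum>j\<in>I. (Y k j x)\<^sup>2 + (Y (k + 1) j x)\<^sup>2)"
          using C1 by (intro ennreal_mult sum_nonneg divide_nonneg_nonneg) auto
        also have "ennreal (\<Sum>j\<in>I. (Y k j x)\<^sup>2 + (Y (k + 1) j x)\<^sup>2)
            = (\<Sum>j\<in>I. ennreal ((Y k j x)\<^sup>2 + (Y (k + 1) j x)\<^sup>2))"
          by (rule sum_ennreal[symmetric]) simp
        finally show ?case by (simp only: ennreal_plus zero_le_power2)
      qed
    qed
    also have "\<dots> = ennreal (C1 / m\<^sup>2) * (\<Sum>j\<in>I. (\<integral>\<^sup>+x. ennreal ((Y k j x)\<^sup>2) \<partial>P)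
        + (\<integral>\<^sup>+x. ennreal ((Y (k + 1) j x)\<^sup>2) \<partial>P))"
    proof -
      have sq: "(\<lambda>x. ennreal ((Y l j x)\<^sup>2)) \<in> borel_measurable P" if "j \<in> I" "1 \<le> l" for j l
      proof -
        note [measurable] = Y_meas[OF that]
        show ?thesis by measurable
      qed
      have add: "(\<lambda>x. ennreal ((Y k j x)\<^sup>2) + ennreal ((Y (k + 1) j x)\<^sup>2)) \<in> borel_measurable P"
        if "j \<in> I" for j
        using sq[OF that] k(1) by (intro borel_measurable_add) auto
      show ?thesis
        using sq add k(1) by (simp add: nn_integral_cmult nn_integral_sum nn_integral_add)
    qed
    also have "\<dots> \<le> ennreal (C1 / m\<^sup>2) * (\<Sum>j\<in>I. ennreal B + ennreal B)"
      using Y_sq by (intro mult_left_mono sum_mono add_mono) auto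
    also have "\<dots> = ennreal (2 * C1 * B / card I)"
    proof -
      have B: "0 \<le> B" by (simp add: B_def)
      then have "ennreal B + ennreal B = ennreal (2 * B)"
        by (simp only: ennreal_plus[symmetric] mult_2)
      then have "(\<Sum>j\<in>I. ennreal B + ennreal B) = ennreal (m * (2 * B))"
        using B by (simp add: m_def ennreal_of_nat_eq_real_of_nat ennreal_mult)
      then have "ennreal (C1 / m\<^sup>2) * (\<Sum>j\<in>I. ennreal B + ennreal B)
          = ennreal (C1 / m\<^sup>2 * (m * (2 * B)))"
        using B C1 m by (simp only: ennreal_mult mult_nonneg_nonneg divide_nonneg_nonneg
            zero_le_power2 less_imp_le zero_le_numeral)
      also have "C1 / m\<^sup>2 * (m * (2 * B)) = 2 * C1 * B / card I"
        using m by (simp add: m_def[symmetric] power2_eq_square)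
      finally show ?thesis .
    qed
    finally show "integrable (PiM I (\<lambda>_. \<mu>)) T \<and> integrable (PiM I (\<lambda>_. \<mu>)) (\<lambda>x. (T x)\<^sup>2) \<and>
        (\<integral>\<^sup>+x. ennreal ((T x - (\<integral>y. T y \<partial>PiM I (\<lambda>_. \<mu>)))\<^sup>2) \<partial>PiM I (\<lambda>_. \<mu>))
        \<le> ennreal (2 * C1 * B / card I)"
      using T_int T2_int by (simp add: P_def)
  qed
qed

end

section \<open>Densities bounded above and below on a regular support\<close>

text \<open>The complement is the union of all open null sets; by the Lindelof property countably many of
  them suffice.\<close>

lemma AE_density_supp:
  fixes p :: "'a::euclidean_space \<Rightarrow> real"
  assumes "finite_measure (density lborel (\<lambda>y. ennreal (p y)))"
  shows "closed (density_supp p)"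
    and "AE x in density lborel (\<lambda>y. ennreal (p y)). x \<in> density_supp p"
proof -
  define \<mu> where "\<mu> = density lborel (\<lambda>y. ennreal (p y))"
  interpret finite_measure \<mu> using assms by (simp add: \<mu>_def)
  define F where "F = {B. open B \<and> B \<in> null_sets \<mu>}"
  have sets_mu: "sets \<mu> = sets borel" by (simp add: \<mu>_def)
  have compl: "- density_supp p = \<Union>F"
  proof
    show "- density_supp p \<subseteq> \<Union>F"
    proof
      fix x assume "x \<in> - density_supp p"
      then obtain r where r: "0 < r" "measure \<mu> (ball x r) \<le> 0"
        by (auto simp: density_supp_def \<mu>_def not_less)
      then have "measure \<mu> (ball x r) = 0" by (simp add: order_antisym)
      then have "ball x r \<in> F" by (auto simp: F_def null_sets_def emeasure_eq_measure sets_mu)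
      then show "x \<in> \<Union>F" using r(1) by (intro UnionI[of "ball x r"]) auto
    qed
    show "\<Union>F \<subseteq> - density_supp p"
    proof
      fix x assume "x \<in> \<Union>F"
      then obtain B where B: "open B" "B \<in> null_sets \<mu>" "x \<in> B" by (auto simp: F_def)
      obtain r where r: "0 < r" "ball x r \<subseteq> B" using B openE by blast
      have "ball x r \<in> null_sets \<mu>"
        by (rule null_sets_subset[OF B(2) _ r(2)]) (simp add: sets_mu)
      then have "\<not> 0 < measure \<mu> (ball x r)" by (simp add: measure_eq_0_null_sets)
      then show "x \<in> - density_supp p"
        using r(1) unfolding density_supp_def \<mu>_def by blast
    qed
  qed
  have "open (\<Union>F)" by (intro open_Union) (auto simp: F_def)
  then show "closed (density_supp p)" by (simp add: closed_def compl)
  obtain F' where F': "F' \<subseteq> F" "countable F'" "\<Union>F' = \<Union>F"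
    using Lindelof[of F] by (auto simp: F_def)
  have "\<Union>F' \<in> null_sets \<mu>"
    using F' null_sets_UN'[of F' "\<lambda>B. B" \<mu>] by (auto simp: F_def)
  then have "AE x in \<mu>. x \<notin> \<Union>F'" by (rule AE_not_in)
  then show "AE x in density lborel (\<lambda>y. ennreal (p y)). x \<in> density_supp p"
    unfolding \<mu>_def[symmetric] F'(3) compl[symmetric] by simp
qed

text \<open>Regularity of the support is available for radii up to \<open>r\<close> only. For \<open>r < \<rho> \<le> D\<close> the ball of radius
  \<open>r\<close> is used instead, at the cost of the factor \<open>\<eta>\<^sup>d\<close> with \<open>\<eta> = min 1 (r / D)\<close>.\<close>

lemma knn_sampling_density:
  fixes p :: "'a::euclidean_space \<Rightarrow> real"
  assumes p_meas: "p \<in> borel_measurable borel"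
    and p_prob: "(\<integral>\<^sup>+x. ennreal (p x) \<partial>lborel) = 1"
    and p_upper: "\<exists>C\<^sub>p>0. AE x in lborel. p x \<le> C\<^sub>p"
    and p_lower: "\<exists>c\<^sub>p>0. \<forall>x\<in>density_supp p. c\<^sub>p \<le> p x"
    and supp_bounded: "bounded (density_supp p)"
    and supp_regular:
      "\<exists>r>0. 0 < (INF x\<in>density_supp p. INF r'\<in>{0<..r}.
                  measure lborel (ball x r' \<inter> density_supp p) / measure lborel (ball x r'))"
  obtains A c D where
    "knn_sampling (density lborel (\<lambda>x. ennreal (p x))) (density_supp p) A c D"
proof -
  define \<mu> where "\<mu> = density lborel (\<lambda>x. ennreal (p x))"
  define S where "S = density_supp p"
  define d where "d = DIM('a)"
  define v where "v = unit_ball_vol (real d)"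
  have v: "0 < v" by (simp add: v_def d_def)
  note [measurable] = p_meas
  have em: "emeasure \<mu> B = (\<integral>\<^sup>+x. ennreal (p x) * indicator B x \<partial>lborel)" if "B \<in> sets borel" for B
    unfolding \<mu>_def using that by (intro emeasure_density) auto
  have sets_mu: "sets \<mu> = sets borel" by (simp add: \<mu>_def)
  interpret prob_space \<mu>
    by (rule prob_spaceI) (use em[of UNIV] p_prob in \<open>simp add: \<mu>_def\<close>)
  have S: "closed S" "AE x in \<mu>. x \<in> S"
    unfolding S_def \<mu>_def
    by (rule AE_density_supp, fact finite_measure_axioms[unfolded \<mu>_def])+
  obtain C\<^sub>p where Cp: "0 < C\<^sub>p" "AE x in lborel. p x \<le> C\<^sub>p" using p_upper by auto
  obtain c\<^sub>p where cp: "0 < c\<^sub>p" "\<And>x. x \<in> S \<Longrightarrow> c\<^sub>p \<le> p x" using p_lower by (auto simp: S_def)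
  obtain D0 where D0: "\<And>x y. x \<in> S \<Longrightarrow> y \<in> S \<Longrightarrow> dist x y \<le> D0"
    using supp_bounded by (auto simp: S_def[symmetric] bounded_two_points)
  define D where "D = max 1 D0"
  have D: "0 < D" by (simp add: D_def)
  define ratio where "ratio x r' = measure lborel (ball x r' \<inter> S) / measure lborel (ball x r')"
    for x :: 'a and r' :: real
  obtain r where r: "0 < r" "0 < (INF x\<in>S. INF r'\<in>{0<..r}. ratio x r')"
    using supp_regular by (auto simp: S_def ratio_def)
  define \<kappa> where "\<kappa> = (INF x\<in>S. INF r'\<in>{0<..r}. ratio x r')"
  have ratio_nonneg: "0 \<le> ratio x r'" for x r' by (simp add: ratio_def)
  have \<kappa>_le: "\<kappa> \<le> ratio x r'" if "x \<in> S" "0 < r'" "r' \<le> r" for x r'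
  proof -
    have "\<kappa> \<le> (INF r'\<in>{0<..r}. ratio x r')"
      unfolding \<kappa>_def using that r(1) ratio_nonneg
      by (intro cINF_lower bdd_belowI2[where m = 0] cINF_greatest) auto
    also have "\<dots> \<le> ratio x r'"
      using that ratio_nonneg by (intro cINF_lower bdd_belowI2[where m = 0]) auto
    finally show ?thesis .
  qed
  define \<eta> where "\<eta> = min 1 (r / D)"
  have \<eta>: "0 < \<eta>" using r(1) D by (simp add: \<eta>_def)
  have "knn_sampling \<mu> S (C\<^sub>p * v) (c\<^sub>p * (\<kappa> * (v * \<eta> ^ d))) D"
  proof unfold_locales
    show "sets \<mu> = sets borel" by (rule sets_mu)
    show "0 < C\<^sub>p * v" using Cp v by simp
    show "0 < c\<^sub>p * (\<kappa> * (v * \<eta> ^ d))" using cp v \<eta> r(2) by (simp add: \<kappa>_def)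
    show "AE x in \<mu>. x \<in> S" by (rule S)
    show "dist x y \<le> D" if "x \<in> S" "y \<in> S" for x y
      using D0[OF that] by (simp add: D_def)
    show "measure \<mu> (cball x \<rho>) \<le> C\<^sub>p * v * \<rho> ^ DIM('a)" if \<rho>: "0 \<le> \<rho>" for x \<rho>
    proof -
      have "emeasure \<mu> (cball x \<rho>) \<le> (\<integral>\<^sup>+y. ennreal C\<^sub>p * indicator (cball x \<rho>) y \<partial>lborel)"
        unfolding em[OF borel_closed[OF closed_cball]]
      proof (rule nn_integral_mono_AE)
        show "AE y in lborel. ennreal (p y) * indicator (cball x \<rho>) y
            \<le> ennreal C\<^sub>p * indicator (cball x \<rho>) y"
          using Cp(2) by eventually_elim (intro mult_right_mono ennreal_leI, auto)
      qed
      also have "\<dots> = ennreal C\<^sub>p * emeasure lborel (cball x \<rho>)"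
        by (simp add: nn_integral_cmult_indicator)
      also have "\<dots> = ennreal (C\<^sub>p * v * \<rho> ^ DIM('a))"
        using \<rho> Cp(1) v by (simp add: emeasure_cball v_def d_def ennreal_mult mult.assoc)
      finally show ?thesis
        using \<rho> Cp(1) v by (simp add: emeasure_eq_measure)
    qed
    show "c\<^sub>p * (\<kappa> * (v * \<eta> ^ d)) * \<rho> ^ DIM('a) \<le> measure \<mu> (cball x \<rho>)"
      if x: "x \<in> S" and \<rho>: "0 \<le> \<rho>" "\<rho> \<le> D" for x \<rho>
    proof (cases "\<rho> = 0")
      case True
      then show ?thesis by (simp add: zero_power)
    next
      case False
      define \<rho>' where "\<rho>' = min \<rho> r"
      have \<rho>': "0 < \<rho>'" "\<rho>' \<le> r" "\<rho>' \<le> \<rho>" using False \<rho> r(1) by (auto simp: \<rho>'_def)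
      have "\<eta> * \<rho> \<le> \<rho>'"
      proof -
        have "\<eta> * \<rho> \<le> 1 * \<rho>" using \<rho>(1) by (intro mult_right_mono) (simp_all add: \<eta>_def)
        moreover have "\<eta> * \<rho> \<le> r / D * D"
          using \<rho> \<eta> r(1) D by (intro mult_mono) (simp_all add: \<eta>_def)
        ultimately show ?thesis using D by (simp add: \<rho>'_def)
      qed
      then have "(\<eta> * \<rho>) ^ d \<le> \<rho>' ^ d" using \<eta> \<rho>(1) by (intro power_mono) auto
      then have "c\<^sub>p * (\<kappa> * (v * (\<eta> * \<rho>) ^ d)) \<le> c\<^sub>p * (\<kappa> * (v * \<rho>' ^ d))"
        using cp(1) v r(2) by (intro mult_left_mono) (auto simp: \<kappa>_def)
      also have "\<kappa> * (v * \<rho>' ^ d) \<le> measure lborel (ball x \<rho>' \<inter> S)"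
      proof -
        have vol: "measure lborel (ball x \<rho>') = v * \<rho>' ^ d"
          using content_ball[of \<rho>' x] \<rho>'(1) by (simp add: v_def d_def)
        have pos: "0 < v * \<rho>' ^ d" using v \<rho>'(1) by simp
        show ?thesis
          using \<kappa>_le[OF x \<rho>'(1,2)] pos unfolding ratio_def vol by (simp add: pos_le_divide_eq)
      qed
      also have "c\<^sub>p * measure lborel (ball x \<rho>' \<inter> S) \<le> measure \<mu> (ball x \<rho>' \<inter> S)"
      proof -
        have fin: "emeasure lborel (ball x \<rho>' \<inter> S) \<noteq> \<infinity>"
          using emeasure_lborel_ball_finite[of x \<rho>']
            emeasure_mono[of "ball x \<rho>' \<inter> S" "ball x \<rho>'" lborel] by (auto simp: top_unique)
        have "ennreal (c\<^sub>p * measure lborel (ball x \<rho>' \<inter> S)) = ennreal c\<^sub>p * emeasure lborel (ball x \<rho>' \<inter> S)"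
          using cp(1) fin by (simp add: ennreal_mult emeasure_eq_ennreal_measure)
        also have "\<dots> = (\<integral>\<^sup>+y. ennreal c\<^sub>p * indicator (ball x \<rho>' \<inter> S) y \<partial>lborel)"
          using S(1) by (simp add: nn_integral_cmult_indicator)
        also have "\<dots> \<le> (\<integral>\<^sup>+y. ennreal (p y) * indicator (ball x \<rho>' \<inter> S) y \<partial>lborel)"
          using cp(2) by (intro nn_integral_mono) (auto intro: ennreal_leI split: split_indicator)
        also have "\<dots> = emeasure \<mu> (ball x \<rho>' \<inter> S)"
          using S(1) by (intro em[symmetric]) auto
        finally show ?thesis by (simp add: emeasure_eq_measure)
      qed
      also have "measure \<mu> (ball x \<rho>' \<inter> S) \<le> measure \<mu> (cball x \<rho>)"
        using \<rho>'(3) by (intro finite_measure_mono) (auto simp: sets_mu)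
      finally show ?thesis
        using cp(1) by (simp add: power_mult_distrib d_def mult_ac)
    qed
  qed
  then show ?thesis using that by (simp add: \<mu>_def S_def)
qed

lemma measure_lborel_ball:
  "measure lborel (ball (x :: 'a::euclidean_space) r) = unit_ball_vol (real DIM('a)) * max 0 r ^ DIM('a)"
proof (cases "0 \<le> r")
  case True
  then show ?thesis using content_ball[of r x] by simp
qed (simp add: max_def zero_power)

text \<open>Dividing the integrand of the Laplace transform at \<open>s = 1\<close> by its positive weight recovers \<open>\<phi>\<close> on the
  positive half line. The value at \<open>0\<close> is kept because it is attained by the estimator when
  sample points coincide.\<close>

lemma estimator_function_measurable:
  assumes "estimator_function k f \<phi>"
  shows "(\<lambda>u. if 0 < u then \<phi> u else \<phi> 0) \<in> borel_measurable borel"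
proof -
  have "set_integrable lborel {0<..} (\<lambda>u. u ^ (k - 1) * \<phi> u * exp (- 1 * u))"
    using assms unfolding estimator_function_def by (metis zero_less_one)
  then have int [measurable]: "(\<lambda>u. indicator {0<..} u *\<^sub>R (u ^ (k - 1) * \<phi> u * exp (- 1 * u)))
      \<in> borel_measurable borel"
    unfolding set_integrable_def using borel_measurable_integrable by fastforce
  have "(\<lambda>u. if 0 < u then (indicator {0<..} u *\<^sub>R (u ^ (k - 1) * \<phi> u * exp (- 1 * u)))
      / (u ^ (k - 1) * exp (- 1 * u)) else \<phi> 0) \<in> borel_measurable borel"
    by measurable
  moreover have "(\<lambda>u. if 0 < u then (indicator {0<..} u *\<^sub>R (u ^ (k - 1) * \<phi> u * exp (- 1 * u)))
      / (u ^ (k - 1) * exp (- 1 * u)) else \<phi> 0) = (\<lambda>u. if 0 < u then \<phi> u else \<phi> 0)"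
    by (auto simp: fun_eq_iff)
  ultimately show ?thesis by simp
qed

theorem mainTheorem5:
  fixes p :: "'a::euclidean_space \<Rightarrow> real"
    and f \<phi> :: "real \<Rightarrow> real"
    and a b :: real
    and k :: nat
    and M :: "'w measure"
    and X :: "nat \<Rightarrow> 'w \<Rightarrow> 'a"
  assumes p_meas: "p \<in> borel_measurable borel"
    and p_nonneg: "\<And>x. 0 \<le> p x"
    and p_prob: "(\<integral>\<^sup>+x. ennreal (p x) \<partial>lborel) = 1"
    and M: "prob_space M"
    and X_indep: "prob_space.indep_vars M (\<lambda>_. borel) X {1..}"
    and X_density: "\<And>i. 1 \<le> i \<Longrightarrow> distributed M lborel (X i) (\<lambda>x. ennreal (p x))"
    and k_pos: "1 \<le> k"
    and k_gt: "real k > - 2 * a"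
    and phi: "estimator_function k f \<phi>"
    and phi_bound: "\<exists>C. \<forall>u>0. \<bar>\<phi> u\<bar> \<le> C * poly_envelope a b u"
    and p_upper: "\<exists>C\<^sub>p>0. AE x in lborel. p x \<le> C\<^sub>p"
    and p_lower: "\<exists>c\<^sub>p>0. \<forall>x\<in>density_supp p. c\<^sub>p \<le> p x"
    and supp_bounded: "bounded (density_supp p)"
    and supp_regular:
      "\<exists>r>0. 0 < (INF x\<in>density_supp p. INF r'\<in>{0<..r}.
                  measure lborel (ball x r' \<inter> density_supp p) / measure lborel (ball x r'))"
  shows "(\<forall>\<^sub>F m in sequentially.
            integrable M (\<lambda>\<omega>. knn_estimator k \<phi> m (\<lambda>i. X i \<omega>)) \<and>
            integrable M (\<lambda>\<omega>. (knn_estimator k \<phi> m (\<lambda>i. X i \<omega>))\<^sup>2)) \<and>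
         (\<lambda>m. prob_space.variance M (\<lambda>\<omega>. knn_estimator k \<phi> m (\<lambda>i. X i \<omega>)))
           \<in> O(\<lambda>m. 1 / real m)"
proof -
  interpret M: prob_space M by (rule M)
  define \<mu> where "\<mu> = density lborel (\<lambda>x. ennreal (p x))"
  define v where "v = unit_ball_vol (real DIM('a))"
  have v: "0 < v" by (simp add: v_def)
  obtain C\<phi> where C\<phi>: "\<And>u. 0 < u \<Longrightarrow> \<bar>\<phi> u\<bar> \<le> C\<phi> * poly_envelope a b u"
    using phi_bound by blast
  obtain A c D where "knn_sampling \<mu> (density_supp p) A c D"
    using knn_sampling_density[OF p_meas p_prob p_upper p_lower supp_bounded supp_regular]
    unfolding \<mu>_def by blast
  then interpret knn_sampling \<mu> "density_supp p" A c D .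
  have \<phi>_eq: "\<phi> u = (if 0 < u then \<phi> u else \<phi> 0)" if "0 \<le> u" for u
    using that by (cases "u = 0") auto
  obtain C where C: "\<And>(I :: nat set) T. finite I \<Longrightarrow> k + 2 \<le> card I \<Longrightarrow>
      T = (\<lambda>x. knn_sum k (volume_stat DIM('a) \<phi> v (card I - 1)) I x / card I) \<Longrightarrow>
      integrable (PiM I (\<lambda>_. \<mu>)) T \<and> integrable (PiM I (\<lambda>_. \<mu>)) (\<lambda>x. (T x)\<^sup>2) \<and>
      (\<integral>\<^sup>+x. ennreal ((T x - (\<integral>y. T y \<partial>PiM I (\<lambda>_. \<mu>)))\<^sup>2) \<partial>PiM I (\<lambda>_. \<mu>)) \<le> ennreal (C / card I)"
    using variance_knn_sum_le[OF k_pos k_gt v C\<phi> estimator_function_measurable[OF phi] \<phi>_eq]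
    by blast
  have X_distr: "distr M borel (X i) = \<mu>" if "1 \<le> i" for i
  proof -
    have "distr M lborel (X i) = \<mu>"
      using X_density[OF that] by (simp add: distributed_def \<mu>_def)
    then show ?thesis by (simp cong: distr_cong)
  qed
  have X_meas: "X i \<in> borel_measurable M" if "1 \<le> i" for i
    using X_density[OF that] by (simp add: distributed_def)
  \<comment> \<open>The sample has law \<open>P\<close>, and the estimator sees it only through the coordinates in \<open>I\<close>.\<close>
  have main: "integrable M (\<lambda>\<omega>. knn_estimator k \<phi> m (\<lambda>i. X i \<omega>)) \<and>
      integrable M (\<lambda>\<omega>. (knn_estimator k \<phi> m (\<lambda>i. X i \<omega>))\<^sup>2) \<and>
      prob_space.variance M (\<lambda>\<omega>. knn_estimator k \<phi> m (\<lambda>i. X i \<omega>)) \<le> max 0 C * (1 / real m)"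
    if m: "k + 2 \<le> m" for m
  proof -
    define I where "I = {1..m}"
    have I: "finite I" "card I = m" "I \<noteq> {}" "\<And>i. i \<in> I \<Longrightarrow> 1 \<le> i" using m by (auto simp: I_def)
    define P where "P = PiM I (\<lambda>_. \<mu>)"
    define V where "V \<omega> = (\<lambda>i\<in>I. X i \<omega>)" for \<omega>
    have V: "V \<in> M \<rightarrow>\<^sub>M P"
    proof -
      have "V \<in> M \<rightarrow>\<^sub>M PiM I (\<lambda>_. borel)"
        unfolding V_def using X_meas I(4) by (intro measurable_restrict) auto
      moreover have sP: "sets P = sets (PiM I (\<lambda>_. borel))"
        unfolding P_def by (intro sets_PiM_cong sets_mu refl)
      ultimately show ?thesis by (simp only: measurable_cong_sets[OF refl sP])
    qed
    have "M.indep_vars (\<lambda>_. borel) X I"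
      by (rule M.indep_vars_subset[OF X_indep]) (auto simp: I_def)
    then have "distr M (PiM I (\<lambda>_. borel)) V = PiM I (\<lambda>i. distr M borel (X i))"
      using M.indep_vars_iff_distr_eq_PiM'[of I X "\<lambda>_. borel"] I X_meas by (simp add: V_def[abs_def])
    also have "\<dots> = P"
      unfolding P_def using X_distr I(4) by (intro PiM_cong) auto
    finally have distr_V: "distr M P V = P"
      using sets_PiM_cong[OF refl, of I "\<lambda>_. borel" "\<lambda>_. \<mu>"] sets_mu
      by (simp add: P_def cong: distr_cong)
    define T where "T = (\<lambda>x :: nat \<Rightarrow> 'a. knn_sum k (volume_stat DIM('a) \<phi> v (card I - 1)) I x / card I)"
    note CT = C[OF I(1) _ T_def, folded P_def]
    have T: "integrable P T" "integrable P (\<lambda>x. (T x)\<^sup>2)"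
      "(\<integral>\<^sup>+x. ennreal ((T x - (\<integral>y. T y \<partial>P))\<^sup>2) \<partial>P) \<le> ennreal (C / m)"
      using CT m I(2) by auto
    have est: "knn_estimator k \<phi> m (\<lambda>i. X i \<omega>) = T (V \<omega>)" for \<omega>
    proof -
      have "knn_estimator k \<phi> m (\<lambda>i. X i \<omega>) = T (\<lambda>i. X i \<omega>)"
        using m unfolding knn_estimator_def knn_volume_def T_def knn_sum_def volume_stat_def
        by (simp add: measure_lborel_ball I_def v_def of_nat_diff)
      also have "\<dots> = T (V \<omega>)"
        unfolding T_def by (subst knn_sum_cong[of I "\<lambda>i. X i \<omega>" "V \<omega>"]) (auto simp: V_def)
      finally show ?thesis .
    qed
    have int: "integrable M (\<lambda>\<omega>. g (V \<omega>))" if "integrable P g" for g :: "(nat \<Rightarrow> 'a) \<Rightarrow> real"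
      using integrable_distr[OF V, of g] that unfolding distr_V by simp
    have expect: "(\<integral>\<omega>. g (V \<omega>) \<partial>M) = (\<integral>x. g x \<partial>P)" if "integrable P g" for g :: "(nat \<Rightarrow> 'a) \<Rightarrow> real"
      using integral_distr[OF V borel_measurable_integrable[OF that]] unfolding distr_V by simp
    interpret P: prob_space P unfolding P_def by (rule prob_space_sample)
    define e where "e = (\<integral>x. T x \<partial>P)"
    have "(\<lambda>x. (T x - e)\<^sup>2) = (\<lambda>x. (T x)\<^sup>2 - 2 * e * T x + e\<^sup>2)"
      by (rule ext) algebra
    then have dev: "integrable P (\<lambda>x. (T x - e)\<^sup>2)"
      using T(1,2) by simp
    have "ennreal (\<integral>x. (T x - e)\<^sup>2 \<partial>P) \<le> ennreal (C / m)"
      using T(3) dev unfolding e_def[symmetric] by (simp add: nn_integral_eq_integral)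
    also have "\<dots> \<le> ennreal (max 0 C / m)"
      by (intro ennreal_leI divide_right_mono) auto
    finally have "(\<integral>x. (T x - e)\<^sup>2 \<partial>P) \<le> max 0 C / m"
      by (simp add: ennreal_le_iff)
    then have "prob_space.variance M (\<lambda>\<omega>. T (V \<omega>)) \<le> max 0 C * (1 / real m)"
      unfolding expect[OF T(1)] e_def[symmetric] expect[OF dev] by simp
    then show ?thesis
      unfolding est using int[OF T(1)] int[OF T(2)] by simp
  qed
  have ev: "\<forall>\<^sub>F m in sequentially. k + 2 \<le> m" by (rule eventually_ge_at_top)
  show ?thesis
  proof
    show "\<forall>\<^sub>F m in sequentially.
        integrable M (\<lambda>\<omega>. knn_estimator k \<phi> m (\<lambda>i. X i \<omega>)) \<and>
        integrable M (\<lambda>\<omega>. (knn_estimator k \<phi> m (\<lambda>i. X i \<omega>))\<^sup>2)"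
      using ev by eventually_elim (use main in blast)
    show "(\<lambda>m. prob_space.variance M (\<lambda>\<omega>. knn_estimator k \<phi> m (\<lambda>i. X i \<omega>)))
        \<in> O(\<lambda>m. 1 / real m)"
    proof (rule bigoI)
      show "\<forall>\<^sub>F m in sequentially. norm (prob_space.variance M (\<lambda>\<omega>. knn_estimator k \<phi> m (\<lambda>i. X i \<omega>)))
          \<le> max 0 C * norm (1 / real m)"
        using ev
      proof eventually_elim
        case (elim m)
        have "0 \<le> prob_space.variance M (\<lambda>\<omega>. knn_estimator k \<phi> m (\<lambda>i. X i \<omega>))"
          by (rule M.variance_positive)
        then show ?case using main[OF elim] by simp
      qed
    qed
  qed
qed

end
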